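(* Let $m,n,k$ be positive integers with $k\le\min\{m,n\}$, $A=[a_{i,j}]\in\mathbb{R}^{m\times n}$, and $W=[w_{i,j}]\in\mathbb{R}^{m\times n}$ with $w_{i,j}>0$ for all $i,j$ and $\sum_{i,j}w_{i,j}=1$. Let $\overline\alpha>0$, $\beta,\iota\in(0,1)$ and $(U_0,\mathbf x_0,V_0)\in\mathcal M=V_k(\mathbb{R}^m)\times\mathbb{R}^k\times V_k(\mathbb{R}^n)$. Let $\{(U_t,\mathbf x_t,V_t)\}_{t=0}^\infty\subset\mathcal M$ be any sequence starting at $(U_0,\mathbf x_0,V_0)$ such that for all $t\ge0$ $$\hat G(U_t,\mathbf x_t,V_t)-\hat G(U_{t+1},\mathbf x_{t+1},V_{t+1})\ \ge\ \hat G(U_t,\mathbf x_t,V_t)-\hat G\big(R_{(U_t,\mathbf x_t,V_t)}(-\tau_t^A\nabla\hat G(U_t,\mathbf x_t,V_t))\big),$$ where $\tau_t^A$ is the Armijo step size of $\hat G$ at $(U_t,\mathbf x_t,V_t)$ for the tangent vector $-\nabla\hat G(U_t,\mathbf x_t,V_t)$ and the scalars $\overline\alpha,\beta,\iota$. Then $\{(U_t,\mathbf x_t,V_t)\}_{t=0}^\infty$ has a subsequence converging to a critical point of $\hat G$, and $\lim_{t\to\infty}\|\nabla\hat G(U_t,\mathbf x_t,V_t)\|=0$.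
   Context: $V_k(\mathbb{R}^n)=\{V\in\mathbb{R}^{n\times k}:V^TV=I_k\}$ is the Stiefel manifold, a Riemannian submanifold of $\mathbb{R}^{n\times k}$ (Frobenius inner product), with $T_XV_k(\mathbb{R}^n)=\{Z\in\mathbb{R}^{n\times k}:X^TZ+Z^TX=0\}$. $\mathcal M$ carries the Riemannian metric induced from $\mathbb{R}^{m\times k}\times\mathbb{R}^k\times\mathbb{R}^{n\times k}$; $\nabla$ denotes the Riemannian gradient. For $\mathbf x=[x_1,\dots,x_k]^T\in\mathbb{R}^k$, $D^{k\times k}_k(\mathbf x)$ is the $k\times k$ diagonal matrix with diagonal entries $x_1,\dots,x_k$. For $(U,\mathbf x,V)\in\mathcal M$ write $[p_{i,j}]=UD^{k\times k}_k(\mathbf x)V^T$ and $$\hat G(U,\mathbf x,V)=\sum_{i=1}^m\sum_{j=1}^n w_{i,j}(a_{i,j}-p_{i,j})^2.$$ For a matrix $C$ with linearly independent columns, $\mathrm{qf}(C)$ is the factor $Q$ in the decomposition $C=QT$ with $Q$ having orthonormal columns and $T$ square upper triangular with positive diagonal entries. The retraction $R$ on $\mathcal M$ is $R_{(U,\mathbf x,V)}(Y,\hat{\mathbf x},Z)=(\mathrm{qf}(U+Y),\mathbf x+\hat{\mathbf x},\mathrm{qf}(V+Z))$ for $(Y,\hat{\mathbf x},Z)\in T_UV_k(\mathbb{R}^m)\times\mathbb{R}^k\times T_VV_k(\mathbb{R}^n)$. Armijo step size: for a differentiable function $f$ on a Riemannian manifold with retraction $R$, a point $x$, a tangent vector $\xi\in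 T_xM$, $\overline\alpha>0$ and $\beta,\iota\in(0,1)$, it is $\tau^A=\beta^N\overline\alpha$, where $N$ is the smallest non-negative integer with $f(x)-f(R_x(\beta^N\overline\alpha\xi))\ge-\iota\langle\nabla f(x),\beta^N\overline\alpha\xi\rangle_x$. *)

theory Defs
  imports "HOL-Analysis.Analysis"
begin

text \<open>
  An \<open>n \<times> k\<close> real matrix is a term of type \<open>real^'k^'n\<close>. The library inner product and norm on
  this type are the Frobenius ones, and those on a product type are the ones of the
  orthogonal direct sum.
\<close>

type_synonym ('m, 'k, 'n) triple =
  "((real, 'k) vec, 'm) vec \<times> (real, 'k) vec \<times> ((real, 'k) vec, 'n) vec"

definition stiefel :: "(real^'k^'n) set" where
  "stiefel = {V. transpose V ** V = mat 1}"

definition stiefel_tangent :: "real^'k^'n \<Rightarrow> (real^'k^'n) set" where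
  "stiefel_tangent X = {Z. transpose X ** Z + transpose Z ** X = 0}"

definition svd_manifold :: "('m::finite, 'k::finite, 'n::finite) triple set" where
  "svd_manifold = stiefel \<times> UNIV \<times> stiefel"

definition svd_tangent ::
    "('m::finite, 'k::finite, 'n::finite) triple \<Rightarrow> ('m, 'k, 'n) triple set" where
  "svd_tangent = (\<lambda>(U, x, V). stiefel_tangent U \<times> UNIV \<times> stiefel_tangent V)"

definition diag_matrix :: "real^'k \<Rightarrow> real^'k^'k" where
  "diag_matrix x = (\<chi> i j. if i = j then x $ i else 0)"

definition G_hat ::
    "real^'n^'m \<Rightarrow> real^'n^'m \<Rightarrow> ('m, 'k::finite, 'n) triple \<Rightarrow> real" where
  "G_hat A W = (\<lambda>(U, x, V).
     let P = U ** diag_matrix x ** transpose V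
     in \<Sum>i\<in>UNIV. \<Sum>j\<in>UNIV. W $ i $ j * (A $ i $ j - P $ i $ j)\<^sup>2)"

text \<open>
  The gradient at \<open>x\<close> of a function \<open>f\<close> on a submanifold \<open>M\<close> of a Euclidean space, with the induced
  metric: \<open>T x\<close> is the tangent space of \<open>M\<close> at \<open>x\<close>, and the differential of \<open>f\<close> at \<open>x\<close> is
  evaluated on velocities of curves in \<open>M\<close> through \<open>x\<close>, so that only the values of \<open>f\<close> on \<open>M\<close> matter.
\<close>

definition riemannian_gradient ::
    "'a::euclidean_space set \<Rightarrow> ('a \<Rightarrow> 'a set) \<Rightarrow> ('a \<Rightarrow> real) \<Rightarrow> 'a \<Rightarrow> 'a" where
  "riemannian_gradient M T f x =
     (THE g. g \<in> T x \<and>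
        (\<forall>\<gamma> \<xi>. (\<forall>t. \<gamma> t \<in> M) \<and> \<gamma> 0 = x \<and> (\<gamma> has_vector_derivative \<xi>) (at (0::real)) \<longrightarrow>
           ((\<lambda>t. f (\<gamma> t)) has_real_derivative inner g \<xi>) (at 0)))"

definition critical_point ::
    "'a::euclidean_space set \<Rightarrow> ('a \<Rightarrow> 'a set) \<Rightarrow> ('a \<Rightarrow> real) \<Rightarrow> 'a \<Rightarrow> bool" where
  "critical_point M T f x \<longleftrightarrow> x \<in> M \<and> riemannian_gradient M T f x = 0"

text \<open>
  The column index type carries a linear order, with respect to which upper triangular is meant.
  The value of \<open>qf C\<close> is meaningful only when the columns of \<open>C\<close> are linearly independent.
\<close>

definition qf :: "((real, 'k::{finite,linorder}) vec, 'n::finite) vec \<Rightarrow> ((real, 'k) vec, 'n) vec" where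
  "qf C = (THE Q. transpose Q ** Q = mat 1 \<and>
     (\<exists>T :: ((real, 'k) vec, 'k) vec. (\<forall>i j. j < i \<longrightarrow> T $ i $ j = 0) \<and> (\<forall>i. 0 < T $ i $ i) \<and> C = Q ** T))"

definition svd_retraction ::
    "('m::finite, 'k::{finite,linorder}, 'n::finite) triple \<Rightarrow>
     ('m, 'k, 'n) triple \<Rightarrow> ('m, 'k, 'n) triple" where
  "svd_retraction = (\<lambda>(U, x, V) (Y, x', Z). (qf (U + Y), x + x', qf (V + Z)))"

definition armijo_step ::
    "'a::euclidean_space set \<Rightarrow> ('a \<Rightarrow> 'a set) \<Rightarrow> ('a \<Rightarrow> 'a \<Rightarrow> 'a) \<Rightarrow> ('a \<Rightarrow> real) \<Rightarrow>
     real \<Rightarrow> real \<Rightarrow> real \<Rightarrow> 'a \<Rightarrow> 'a \<Rightarrow> real" where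
  "armijo_step M T R f \<alpha> \<beta> \<iota> x \<xi> =
     \<beta> ^ (LEAST N. f x - f (R x ((\<beta> ^ N * \<alpha>) *\<^sub>R \<xi>))
                    \<ge> - \<iota> * inner (riemannian_gradient M T f x) ((\<beta> ^ N * \<alpha>) *\<^sub>R \<xi>)) * \<alpha>"

abbreviation grad_G_hat ::
    "real^'n^'m \<Rightarrow> real^'n^'m \<Rightarrow>
     ('m, 'k::finite, 'n) triple \<Rightarrow> ('m, 'k, 'n) triple" where
  "grad_G_hat A W \<equiv> riemannian_gradient svd_manifold svd_tangent (G_hat A W)"

end

theory Submission
  imports Defs
begin

text \<open>
  The key point is that the retraction is of second order with a uniform constant. For a tangent
  vector \<open>Y\<close> at \<open>U\<close>, write \<open>U + Y = Q T\<close>. Then \<open>T\<^sup>T T = I + Y\<^sup>T Y\<close>, which never shrinks a vector, so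
  every \<open>T\<^sub>i\<^sub>i\<close> is at least 1 and the upper triangular \<open>N = T - I\<close> satisfies
  \<open>\<parallel>N\<parallel>\<^sup>2 = \<parallel>Y\<parallel>\<^sup>2 - 2 tr N \<le> \<parallel>Y\<parallel>\<^sup>2\<close>. Since \<open>N + N\<^sup>T = Y\<^sup>T Y - N\<^sup>T N\<close> and \<open>\<parallel>N\<parallel> \<le> \<parallel>N + N\<^sup>T\<parallel>\<close>, this improves to
  \<open>\<parallel>qf (U + Y) - (U + Y)\<parallel> = \<parallel>N\<parallel> \<le> 2 \<parallel>Y\<parallel>\<^sup>2\<close>. No differentiability of \<open>qf\<close> is needed.

  As \<open>G\<close> is a polynomial and its sublevel sets in the manifold are compact, a step of length \<open>s \<le> \<alpha>\<close>
  along minus the gradient \<open>g\<close> decreases \<open>G\<close> by at least \<open>s \<parallel>g\<parallel>\<^sup>2 - C s\<^sup>2 \<parallel>g\<parallel>\<^sup>2\<close>, uniformly over the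
  iterates. Hence the Armijo step sizes are bounded below, \<open>\<Sum> \<parallel>g\<^sub>t\<parallel>\<^sup>2\<close> is finite, and the gradient,
  which is the tangential projection of the Euclidean one and so continuous, vanishes at every
  limit point of the iterates.
\<close>

section \<open>Matrices with the Frobenius norm\<close>

lemma transpose_matrix_mult_nth:
  "(transpose A ** B) $ i $ j = inner (column i A) (column j (B :: real^'k^'n))"
  by (simp add: matrix_matrix_mult_def transpose_def column_def inner_vec_def)

text \<open>Both sides are the same triple sum, taken in different orders. The rule moves a factor
  with orthonormal columns across the inner product, where it meets its transpose and
  cancels.\<close>

lemma inner_matrix_mult_left:
  fixes A :: "real^'k^'n" and B :: "real^'l^'k" and C :: "real^'l^'n"
  shows "inner (A ** B) C = inner B (transpose A ** C)"
proof -
  have "inner (A ** B) C = (\<Sum>i\<in>UNIV. \<Sum>j\<in>UNIV. \<Sum>l\<in>UNIV. A$i$l * B$l$j * C$i$j)"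
    by (simp add: inner_vec_def matrix_matrix_mult_def sum_distrib_right)
  also have "\<dots> = (\<Sum>j\<in>UNIV. \<Sum>l\<in>UNIV. \<Sum>i\<in>UNIV. A$i$l * B$l$j * C$i$j)"
    by (subst sum.swap) (rule sum.cong[OF refl], rule sum.swap)
  also have "\<dots> = (\<Sum>l\<in>UNIV. \<Sum>j\<in>UNIV. \<Sum>i\<in>UNIV. A$i$l * B$l$j * C$i$j)"
    by (rule sum.swap)
  also have "\<dots> = inner B (transpose A ** C)"
    by (simp add: inner_vec_def matrix_matrix_mult_def transpose_def sum_distrib_left mult_ac)
  finally show ?thesis .
qed

lemma inner_transpose:
  fixes A B :: "real^'k^'n"
  shows "inner (transpose A) (transpose B) = inner A B"
  unfolding inner_vec_def transpose_def by (simp) (rule sum.swap)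

lemma norm_transpose:
  fixes A :: "real^'k^'n"
  shows "norm (transpose A) = norm A"
  by (simp add: norm_eq_sqrt_inner inner_transpose)

text \<open>Each entry of the product is a row of \<open>A\<close> paired with a column of
  \<open>B\<close>, so Cauchy-Schwarz applies entry by entry.\<close>

lemma norm_matrix_mult_le:
  fixes A :: "real^'k^'n" and B :: "real^'l^'k"
  shows "norm (A ** B) \<le> norm A * norm B"
proof -
  have ent: "(A ** B)$i$j = inner (A$i) (transpose B $ j)" for i j
    by (simp add: inner_vec_def matrix_matrix_mult_def transpose_def)
  have "(norm (A ** B))\<^sup>2 = (\<Sum>i\<in>UNIV. \<Sum>j\<in>UNIV. (inner (A$i) (transpose B $ j))\<^sup>2)"
    by (simp add: power2_norm_eq_inner inner_vec_def[of "A ** B"] inner_vec_def[of "(A ** B) $ _"] ent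
        flip: power2_eq_square)
  also have "\<dots> \<le> (\<Sum>i\<in>UNIV. \<Sum>j\<in>UNIV. inner (A$i) (A$i) * inner (transpose B $ j) (transpose B $ j))"
    by (intro sum_mono Cauchy_Schwarz_ineq)
  also have "\<dots> = inner A A * inner (transpose B) (transpose B)"
    by (simp add: inner_vec_def[of A] inner_vec_def[of "transpose B"] sum_product)
  also have "\<dots> = (norm A * norm B)\<^sup>2"
    by (simp add: inner_transpose power_mult_distrib power2_norm_eq_inner)
  finally show ?thesis
    by (meson mult_nonneg_nonneg norm_ge_zero power2_le_imp_le)
qed

text \<open>Makes the general rules for sums, scalings, continuity and derivatives available for
  matrix products.\<close>

lemma bounded_bilinear_matrix_mult:
  "bounded_bilinear ((**) :: real^'k^'n \<Rightarrow> real^'l^'k \<Rightarrow> real^'l^'n)"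
proof
  show "\<exists>K. \<forall>a b. norm ((a :: real^'k^'n) ** (b :: real^'l^'k)) \<le> norm a * norm b * K"
    by (rule exI[of _ 1]) (simp add: norm_matrix_mult_le)
qed (simp_all add: matrix_matrix_mult_def vec_eq_iff algebra_simps sum.distrib sum_distrib_left)

lemma bounded_linear_transpose:
  "bounded_linear (transpose :: real^'k^'n \<Rightarrow> real^'n^'k)"
  by (rule bounded_linear_intro[where K = 1]) (simp_all add: norm_transpose, simp_all add: transpose_def vec_eq_iff)

lemma transpose_add: "transpose (A + B) = transpose A + transpose (B :: real^'k^'n)"
  by (simp add: transpose_def vec_eq_iff)

lemma transpose_minus: "transpose (- A) = - transpose (A :: real^'k^'n)"
  by (simp add: transpose_def vec_eq_iff)

section \<open>QR decomposition\<close>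

text \<open>This is the condition that \<open>qf\<close> imposes on its triangular factor.\<close>

definition upper_triangular_pos :: "((real, 'k::{finite,linorder}) vec, 'k) vec \<Rightarrow> bool" where
  "upper_triangular_pos T \<longleftrightarrow> (\<forall>i j. j < i \<longrightarrow> T $ i $ j = 0) \<and> (\<forall>i. 0 < T $ i $ i)"

text \<open>The number of elements below \<open>i\<close> drops strictly when passing to a smaller
  element. This allows arguments column by column.\<close>

lemma finite_linorder_induct [case_names less]:
  fixes i :: "'k::{finite,linorder}"
  assumes "\<And>i. (\<And>j. j < i \<Longrightarrow> P j) \<Longrightarrow> P i"
  shows "P i"
proof (induction i rule: measure_induct_rule[of "\<lambda>i. card {..<i}"])
  case (less i)
  show ?case
  proof (rule assms)
    fix j assume "j < i"
    then have "{..<j} \<subset> {..<i}" by auto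
    then show "P j" using less by (simp add: psubset_card_mono)
  qed
qed

lemma column_matrix_mult:
  fixes Q :: "real^'k^'n" and T :: "real^'l^'k"
  shows "column j (Q ** T) = (\<Sum>i\<in>UNIV. T$i$j *\<^sub>R column i Q)"
  by (simp add: vec_eq_iff column_def matrix_matrix_mult_def mult.commute)

lemma orthonormal_columns_iff:
  fixes Q :: "real^'k^'n"
  shows "transpose Q ** Q = mat 1 \<longleftrightarrow>
    (\<forall>i j. inner (column i Q) (column j Q) = (if i = j then 1 else 0))"
  by (simp add: vec_eq_iff transpose_matrix_mult_nth mat_def)

text \<open>Gram-Schmidt: \<open>p j\<close> is the projection of column \<open>j\<close> onto the
  span \<open>E j\<close> of the earlier columns, and \<open>r j\<close> is the residue. The
  hypothesis is a quantitative form of independence of the columns, which yields the lower bound on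
  the diagonal of \<open>T\<close>.\<close>

lemma qr_exists:
  fixes C :: "((real, 'k::{finite,linorder}) vec, 'n::finite) vec"
  assumes C: "\<And>v. norm v \<le> norm (C *v v)"
  obtains Q T where "transpose Q ** Q = mat 1" "upper_triangular_pos T" "\<And>i. 1 \<le> T $ i $ i" "C = Q ** T"
proof -
  define E where "E j = span ((\<lambda>i. column i C) ` {..<j})" for j
  have "\<exists>p r. p \<in> E j \<and> (\<forall>w\<in>E j. inner r w = 0) \<and> column j C = p + r" for j
    using orthogonal_subspace_decomp_exists[of "(\<lambda>i. column i C) ` {..<j}" "column j C"]
    unfolding E_def orthogonal_def by metis
  then obtain p r where p: "\<And>j. p j \<in> E j" and r: "\<And>j w. w \<in> E j \<Longrightarrow> inner (r j) w = 0"
    and pr: "\<And>j. column j C = p j + r j" by metis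
  have colE: "column i C \<in> E j" if "i < j" for i j
    using that unfolding E_def by (intro span_base) auto
  have Emono: "E i \<subseteq> E j" if "i \<le> j" for i j
    unfolding E_def using that by (intro span_mono) auto
  \<comment> \<open>Earlier residues lie in the span to which \<open>r j\<close> is orthogonal, so
    the residues are pairwise orthogonal.\<close>
  have rE: "r i \<in> E j" if "i < j" for i j
  proof -
    have "r i = column i C - p i" using pr[of i] by simp
    moreover have "p i \<in> E j" using p[of i] Emono[OF less_imp_le[OF that]] by auto
    ultimately show ?thesis using colE[OF that] unfolding E_def by (simp add: span_diff)
  qed
  have rr: "inner (r i) (r j) = 0" if "i \<noteq> j" for i j
  proof (cases "i < j")
    case True
    then show ?thesis using r[OF rE] by (simp add: inner_commute)
  next
    case False
    then have "j < i" using that by simp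
    then show ?thesis using r[OF rE] by simp
  qed
  \<comment> \<open>\<open>r j\<close> is \<open>C *v v\<close> for some \<open>v\<close> with \<open>v $ j = 1\<close>, so the expansion hypothesis bounds its norm below.\<close>
  have norm_r: "1 \<le> norm (r j)" for j
  proof -
    have "E j \<subseteq> {C *v w |w. w $ j = 0}"
      unfolding E_def
    proof (rule span_minimal)
      show "(\<lambda>i. column i C) ` {..<j} \<subseteq> {C *v w |w. w $ j = 0}"
      proof clarify
        fix i assume "i < j"
        then show "\<exists>w. column i C = C *v w \<and> w $ j = 0"
          by (intro exI[of _ "axis i 1"]) (simp add: matrix_vector_mult_basis, simp add: axis_def)
      qed
      show "subspace {C *v w |w. w $ j = 0}"
      proof (rule subspaceI)
        show "0 \<in> {C *v w |w. w $ j = 0}"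
          by (auto intro!: exI[of _ 0])
      next
        fix x y assume "x \<in> {C *v w |w. w $ j = 0}" "y \<in> {C *v w |w. w $ j = 0}"
        then obtain a b where "x = C *v a" "y = C *v b" "a $ j = 0" "b $ j = 0" by auto
        then show "x + y \<in> {C *v w |w. w $ j = 0}"
          by (auto intro!: exI[of _ "a + b"] simp: matrix_vector_right_distrib)
      next
        fix c x assume "x \<in> {C *v w |w. w $ j = 0}"
        then obtain a where "x = C *v a" "a $ j = 0" by auto
        then show "c *\<^sub>R x \<in> {C *v w |w. w $ j = 0}"
          by (auto intro!: exI[of _ "c *\<^sub>R a"] simp: matrix_vector_mult_scaleR)
      qed
    qed
    then obtain w where w: "p j = C *v w" "w $ j = 0" using p[of j] by auto
    have "r j = C *v (axis j 1 - w)"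
      using pr[of j] w by (simp add: matrix_vector_mult_diff_distrib matrix_vector_mult_basis)
    moreover have "1 \<le> norm (axis j 1 - w)"
      using component_le_norm_cart[of "axis j 1 - w" j] w by simp
    ultimately show ?thesis using C[of "axis j 1 - w"] by simp
  qed
  define q where "q j = r j /\<^sub>R norm (r j)" for j
  define Q where "Q = (\<chi> i j. q j $ i)"
  define T where "T = (\<chi> i j. inner (q i) (column j C))"
  have colQ: "column j Q = q j" for j by (simp add: Q_def column_def vec_eq_iff)
  have rnz: "norm (r j) \<noteq> 0" for j using norm_r[of j] by linarith
  have qq: "inner (q i) (q j) = (if i = j then 1 else 0)" for i j
  proof (cases "i = j")
    case True
    then show ?thesis using rnz[of j]
      by (simp add: q_def field_simps flip: power2_norm_eq_inner)
  next
    case False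
    then show ?thesis using rr[of i j] by (simp add: q_def)
  qed
  have rq: "r j = norm (r j) *\<^sub>R q j" for j using rnz[of j] by (simp add: q_def)
  have T0: "T $ i $ j = 0" if "j < i" for i j
    using r[OF colE[OF that]] by (simp add: T_def q_def)
  have Td: "T $ j $ j = norm (r j)" for j
  proof -
    have "inner (r j) (column j C) = norm (r j) * norm (r j)"
      using r[OF p[of j]] by (simp add: pr inner_add_right power2_norm_eq_inner flip: power2_eq_square)
    then show ?thesis using rnz[of j] by (simp add: T_def q_def)
  qed
  \<comment> \<open>The vectors \<open>q i\<close> need not span the whole space. Expanding a column
    of \<open>C\<close> in them is legitimate only because the column lies in their span.\<close>
  have span_q: "column j C \<in> span (range q)" for j
  proof (induction j rule: finite_linorder_induct)
    case (less j)
    have "E j \<subseteq> span (range q)"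
      unfolding E_def using less by (intro span_minimal) auto
    moreover have "r j \<in> span (range q)"
      by (subst rq) (intro span_scale span_base rangeI)
    ultimately show ?case using p[of j] by (simp add: pr span_add subset_eq)
  qed
  have expand: "v = (\<Sum>i\<in>UNIV. inner (q i) v *\<^sub>R q i)" if "v \<in> span (range q)" for v
    using that
  proof (induction v rule: span_induct_alt)
    case base
    then show ?case by simp
  next
    case (step c x y)
    then obtain i where x: "x = q i" by auto
    have "(\<Sum>l\<in>UNIV. inner (q l) (c *\<^sub>R x + y) *\<^sub>R q l)
      = c *\<^sub>R (\<Sum>l\<in>UNIV. inner (q l) x *\<^sub>R q l) + (\<Sum>l\<in>UNIV. inner (q l) y *\<^sub>R q l)"
      by (simp add: inner_add_right scaleR_add_left sum.distrib scaleR_sum_right)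
    also have "(\<Sum>l\<in>UNIV. inner (q l) x *\<^sub>R q l) = x"
      by (simp add: x qq if_distrib[of "\<lambda>c. c *\<^sub>R _"] cong: if_cong)
    finally show ?case using step by simp
  qed
  have "column j C = column j (Q ** T)" for j
    using expand[OF span_q[of j]] by (simp add: column_matrix_mult colQ T_def)
  then have "C = Q ** T"
    by (simp add: vec_eq_iff column_def)
  moreover have "transpose Q ** Q = mat 1"
    by (simp add: orthonormal_columns_iff colQ qq)
  moreover have "1 \<le> T $ i $ i" for i using norm_r Td by simp
  moreover from this have "0 < T $ i $ i" for i
    by (meson less_le_trans zero_less_one)
  ultimately show ?thesis
    using that T0 unfolding upper_triangular_pos_def by blast
qed

text \<open>Induction over the columns: once the earlier columns agree, so do the coefficients of
  column \<open>j\<close> along them, hence also the remaining multiples of column \<open>j\<close>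
  of \<open>Q\<close> and \<open>Q'\<close>. Unit length and positivity of the diagonal then force
  these columns to coincide.\<close>

lemma qr_unique:
  fixes Q Q' :: "((real, 'k::{finite,linorder}) vec, 'n::finite) vec"
  assumes Q: "transpose Q ** Q = mat 1" and Q': "transpose Q' ** Q' = mat 1"
    and T: "upper_triangular_pos T" and T': "upper_triangular_pos T'"
    and eq: "Q ** T = Q' ** T'"
  shows "Q = Q'"
proof -
  have coef: "inner (column i R) (column j (R ** X)) = X $ i $ j"
    if "transpose R ** R = mat 1" for R :: "((real, 'k) vec, 'n) vec" and X i j
  proof -
    have "transpose R ** (R ** X) = X" 
      by (simp add: matrix_mul_assoc that)
    then show ?thesis by (metis transpose_matrix_mult_nth)
  qed
  have split: "column j (R ** X) = (\<Sum>i | i < j. X$i$j *\<^sub>R column i R) + X$j$j *\<^sub>R column j R"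
    if "upper_triangular_pos X" for R :: "((real, 'k) vec, 'n) vec" and X j
  proof -
    have "column j (R ** X) = (\<Sum>i\<in>insert j {i. i < j}. X$i$j *\<^sub>R column i R)"
      unfolding column_matrix_mult
      by (rule sum.mono_neutral_right) (use that in \<open>auto simp: upper_triangular_pos_def\<close>)
    then show ?thesis by (simp add: add.commute)
  qed
  have "column j Q = column j Q'" for j
  proof (induction j rule: finite_linorder_induct)
    case (less j)
    have "T$i$j = T'$i$j" if "i < j" for i
      using coef[OF Q, of i j T] coef[OF Q', of i j T'] less[OF that] eq by simp
    then have "(\<Sum>i | i < j. T$i$j *\<^sub>R column i Q) = (\<Sum>i | i < j. T'$i$j *\<^sub>R column i Q')"
      using less by (intro sum.cong) auto
    then have e: "T$j$j *\<^sub>R column j Q = T'$j$j *\<^sub>R column j Q'"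
      using split[OF T, of j Q] split[OF T', of j Q'] eq by simp
    have n: "norm (column j Q) = 1" "norm (column j Q') = 1"
      using Q Q' by (simp_all add: orthonormal_columns_iff norm_eq_sqrt_inner)
    have pos: "0 < T$j$j" "0 < T'$j$j" using T T' by (auto simp: upper_triangular_pos_def)
    have "T$j$j = T'$j$j" using arg_cong[OF e, of norm] n pos by simp
    then show ?case using e pos by simp
  qed
  then show ?thesis by (simp add: vec_eq_iff column_def)
qed

text \<open>Uniqueness of the decomposition evaluates the definite description in \<open>qf\<close>
  as soon as one decomposition is exhibited.\<close>

lemma qf_eq:
  fixes Q :: "((real, 'k::{finite,linorder}) vec, 'n::finite) vec"
  assumes "transpose Q ** Q = mat 1" "upper_triangular_pos T"
  shows "qf (Q ** T) = Q"
  unfolding qf_def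
proof (rule the_equality)
  show "transpose Q ** Q = mat 1 \<and> (\<exists>T'. (\<forall>i j. j < i \<longrightarrow> T' $ i $ j = 0) \<and> (\<forall>i. 0 < T' $ i $ i) \<and> Q ** T = Q ** T')"
    using assms unfolding upper_triangular_pos_def by blast
next
  fix Q' :: "((real, 'k) vec, 'n) vec"
  assume "transpose Q' ** Q' = mat 1 \<and> (\<exists>T'. (\<forall>i j. j < i \<longrightarrow> T' $ i $ j = 0) \<and> (\<forall>i. 0 < T' $ i $ i) \<and> Q ** T = Q' ** T')"
  then show "Q' = Q" using assms qr_unique[of Q' Q] unfolding upper_triangular_pos_def by metis
qed

section \<open>Tangent vectors and the second-order estimate for \<open>qf\<close>\<close>

lemma norm_upper_triangular_le:
  fixes N :: "((real, 'k::{finite,linorder}) vec, 'k) vec"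
  assumes "\<And>i j. j < i \<Longrightarrow> N $ i $ j = 0"
  shows "norm N \<le> norm (N + transpose N)"
proof (intro norm_le_componentwise_cart)
  fix i j
  \<comment> \<open>Off the diagonal one of the two factors is zero; on the diagonal the product is
    a square.\<close>
  have "0 \<le> N$i$j * N$j$i" using assms by (cases i j rule: linorder_cases) auto
  then have "(N$i$j)\<^sup>2 \<le> (N$i$j + N$j$i)\<^sup>2"
    unfolding power2_sum using zero_le_power2[of "N$j$i"] by linarith
  then show "norm (N$i$j) \<le> norm ((N + transpose N)$i$j)"
    by (simp add: transpose_def abs_le_square_iff)
qed

text \<open>Tangency says that \<open>transpose U ** Y\<close> is antisymmetric, so its trace and
  its quadratic form vanish.\<close>

lemma stiefel_tangent_inner:
  assumes "Y \<in> stiefel_tangent U"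
  shows "inner U Y = 0" "inner (U *v v) (Y *v v) = 0"
proof -
  have an: "transpose Y ** U = - (transpose U ** Y)"
    using assms by (simp add: stiefel_tangent_def add_eq_0_iff)
  have "inner U Y = inner (U ** mat 1) Y" by simp
  also have "\<dots> = inner (mat 1) (transpose U ** Y)" by (rule inner_matrix_mult_left)
  finally have 1: "inner U Y = inner (mat 1) (transpose U ** Y)" .
  have "inner U Y = inner (Y ** mat 1) U" by (simp add: inner_commute)
  also have "\<dots> = - inner (mat 1) (transpose U ** Y)" unfolding inner_matrix_mult_left an by simp
  finally show "inner U Y = 0" using 1 by simp
  have adj: "inner (A *v v) (B *v v) = inner v ((transpose A ** B) *v v)" for A B
    by (metis dot_lmul_matrix matrix_vector_mul_assoc transpose_matrix_vector transpose_transpose)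
  have "inner (U *v v) (Y *v v) = inner v ((transpose U ** Y) *v v)" by (rule adj)
  moreover have "inner (Y *v v) (U *v v) = - inner v ((transpose U ** Y) *v v)"
    unfolding adj an by (simp add: matrix_vector_mult_def inner_vec_def sum_negf)
  ultimately show "inner (U *v v) (Y *v v) = 0" by (simp add: inner_commute)
qed

lemma stiefel_norm_mult:
  assumes "U \<in> stiefel"
  shows "norm (U ** B) = norm B" "norm (U *v v) = norm v"
proof -
  have U: "transpose U ** U = mat 1" using assms by (simp add: stiefel_def)
  have "inner (U ** B) (U ** B) = inner B B"
    by (simp add: inner_matrix_mult_left matrix_mul_assoc U)
  then show "norm (U ** B) = norm B" by (simp add: norm_eq_sqrt_inner)
  have "inner (U *v v) (U *v v) = inner v v"
    by (metis U dot_lmul_matrix matrix_vector_mul_assoc matrix_vector_mul_lid transpose_matrix_vector transpose_transpose)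
  then show "norm (U *v v) = norm v" by (simp add: norm_eq_sqrt_inner)
qed

text \<open>These two facts are all that the convergence argument uses about \<open>qf\<close>. The
  constant 2 serves tangent vectors of every length, so no radius of validity has to be
  tracked.\<close>

lemma qf_tangent:
  fixes U Y :: "((real, 'k::{finite,linorder}) vec, 'n::finite) vec"
  assumes U: "U \<in> stiefel" and Y: "Y \<in> stiefel_tangent U"
  shows "qf (U + Y) \<in> stiefel" "norm (qf (U + Y) - (U + Y)) \<le> 2 * (norm Y)\<^sup>2"
proof -
  have UU: "transpose U ** U = mat 1" using U by (simp add: stiefel_def)
  have "norm v \<le> norm ((U + Y) *v v)" for v
  proof -
    have "(norm v)\<^sup>2 \<le> (norm (U *v v + Y *v v))\<^sup>2"
      using stiefel_norm_mult(2)[OF U, of v] stiefel_tangent_inner(2)[OF Y, of v]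
      by (simp add: norm_add_Pythagorean orthogonal_def)
    then show ?thesis by (simp add: matrix_vector_mult_add_rdistrib abs_le_square_iff)
  qed
  then obtain Q T where Q: "transpose Q ** Q = mat 1" and T: "upper_triangular_pos T"
    and T1: "\<And>i. 1 \<le> T $ i $ i" and C: "U + Y = Q ** T" by (rule qr_exists) blast
  have q: "qf (U + Y) = Q" unfolding C by (rule qf_eq[OF Q T])
  have Qst: "Q \<in> stiefel" using Q by (simp add: stiefel_def)
  then show "qf (U + Y) \<in> stiefel" using q by simp
  define N where "N = T - mat 1"
  have T_N: "T = mat 1 + N" by (simp add: N_def)
  have tT: "(norm T)\<^sup>2 = (norm (mat 1 :: ((real, 'k) vec, 'k) vec))\<^sup>2 + (norm Y)\<^sup>2"
  proof -
    have "(norm T)\<^sup>2 = (norm (U + Y))\<^sup>2" unfolding C using stiefel_norm_mult(1)[OF Qst] by metis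
    also have "\<dots> = (norm U)\<^sup>2 + (norm Y)\<^sup>2"
      using stiefel_tangent_inner(1)[OF Y] by (simp add: norm_add_Pythagorean orthogonal_def)
    finally show ?thesis using stiefel_norm_mult(1)[OF U, of "mat 1"] by simp
  qed
  have tr: "inner (mat 1) T \<ge> (norm (mat 1 :: ((real, 'k) vec, 'k) vec))\<^sup>2"
  proof -
    have "inner (mat 1) X = (\<Sum>i\<in>UNIV. X$i$i)" for X :: "((real, 'k) vec, 'k) vec"
      by (simp add: inner_vec_def mat_def if_distrib[of "\<lambda>c. c * _"] cong: if_cong)
    from this[of T] this[of "mat 1"] show ?thesis
      unfolding power2_norm_eq_inner using T1 sum_mono[of UNIV "\<lambda>_. 1" "\<lambda>i. T $ i $ i"] by (simp add: mat_def)
  qed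
  \<comment> \<open>Expanding the squared norm of \<open>T - mat 1\<close> gives the squared norm of
    \<open>Y\<close> plus twice the number of columns minus twice the trace of \<open>T\<close>, and
    that trace is at least the number of columns.\<close>
  have N1: "(norm N)\<^sup>2 \<le> (norm Y)\<^sup>2"
    using tT tr unfolding N_def power2_norm_eq_inner by (simp add: inner_diff inner_commute)
  \<comment> \<open>Comparing Gram matrices eliminates \<open>Q\<close>, and the cross terms of
    \<open>U\<close> and \<open>Y\<close> cancel by tangency. Substituting
    \<open>T = mat 1 + N\<close> shows that \<open>N + transpose N\<close> is of second
    order.\<close>
  have "transpose T ** T = transpose (U + Y) ** (U + Y)"
    unfolding C by (metis Q matrix_mul_assoc matrix_mul_lid matrix_transpose_mul)
  also have "\<dots> = mat 1 + transpose Y ** Y"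
    using Y UU by (simp add: stiefel_tangent_def transpose_add matrix_add_ldistrib bounded_bilinear.add_left[OF bounded_bilinear_matrix_mult]) (simp add: algebra_simps)
  finally have "N + transpose N = transpose Y ** Y - transpose N ** N"
    unfolding T_N by (simp add: transpose_add matrix_add_ldistrib bounded_bilinear.add_left[OF bounded_bilinear_matrix_mult] transpose_mat algebra_simps)
  moreover have "norm (transpose Y ** Y - transpose N ** N) \<le> norm Y * norm Y + norm N * norm N"
    by (metis norm_triangle_le_diff add_mono norm_matrix_mult_le norm_transpose)
  ultimately have "norm (N + transpose N) \<le> 2 * (norm Y)\<^sup>2"
    using N1 by (simp add: power2_eq_square)
  moreover have "norm N \<le> norm (N + transpose N)"
    using T by (intro norm_upper_triangular_le) (auto simp: N_def upper_triangular_pos_def mat_def)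
  moreover have "qf (U + Y) - (U + Y) = - (Q ** N)"
    unfolding q unfolding C T_N by (simp add: matrix_add_ldistrib)
  ultimately show "norm (qf (U + Y) - (U + Y)) \<le> 2 * (norm Y)\<^sup>2"
    using stiefel_norm_mult(1)[OF Qst, of N] by simp
qed

section \<open>The Stiefel manifold\<close>

text \<open>For \<open>X\<close> in the Stiefel manifold this is the orthogonal projection onto the
  tangent space at \<open>X\<close>: it removes \<open>X\<close> times the symmetric part of
  \<open>transpose X ** Z\<close>.\<close>

definition stiefel_proj :: "real^'k^'n \<Rightarrow> real^'k^'n \<Rightarrow> real^'k^'n" where
  "stiefel_proj X Z = Z - (1/2) *\<^sub>R (X ** (transpose X ** Z + transpose Z ** X))"

text \<open>As \<open>X\<close> has orthonormal columns, the correction takes half of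
  \<open>S\<close> away from each of the two summands of the tangency condition, and these summands
  add up to \<open>S\<close>.\<close>

lemma stiefel_proj_tangent:
  assumes "X \<in> stiefel"
  shows "stiefel_proj X Z \<in> stiefel_tangent X"
proof -
  define S where "S = transpose X ** Z + transpose Z ** X"
  have XX: "transpose X ** X = mat 1" using assms by (simp add: stiefel_def)
  have tS: "transpose S = S"
    by (simp add: S_def transpose_add matrix_transpose_mul add.commute)
  have "transpose X ** (X ** S) = S" by (simp add: matrix_mul_assoc XX)
  moreover have "transpose (X ** S) ** X = S"
    by (metis XX matrix_mul_assoc matrix_mul_rid matrix_transpose_mul tS)
  moreover have "transpose (Z - (1/2) *\<^sub>R (X ** S)) = transpose Z - (1/2) *\<^sub>R transpose (X ** S)"
    by (simp add: vec_eq_iff transpose_def)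
  ultimately show ?thesis
    unfolding stiefel_tangent_def stiefel_proj_def S_def[symmetric]
    by (simp add: bounded_bilinear.diff_left[OF bounded_bilinear_matrix_mult]
        bounded_bilinear.diff_right[OF bounded_bilinear_matrix_mult]
        bounded_bilinear.scaleR_left[OF bounded_bilinear_matrix_mult]
        bounded_bilinear.scaleR_right[OF bounded_bilinear_matrix_mult])
      (simp add: S_def algebra_simps flip: scaleR_add_left)
qed

text \<open>The correction \<open>X ** S\<close> pairs with \<open>Y\<close> as the symmetric
  \<open>S\<close> with the antisymmetric \<open>transpose X ** Y\<close>, which gives zero.\<close>

lemma inner_stiefel_proj:
  assumes "Y \<in> stiefel_tangent X"
  shows "inner (stiefel_proj X Z) Y = inner Z Y"
proof -
  define S where "S = transpose X ** Z + transpose Z ** X"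
  have tS: "transpose S = S"
    by (simp add: S_def transpose_add matrix_transpose_mul add.commute)
  have "transpose (transpose X ** Y) = - (transpose X ** Y)"
    using assms by (simp add: stiefel_tangent_def matrix_transpose_mul transpose_minus add_eq_0_iff2)
  then have "inner S (transpose X ** Y) = inner S (- (transpose X ** Y))"
    by (metis inner_transpose tS)
  then have "inner (X ** S) Y = 0" by (simp add: inner_matrix_mult_left)
  then show ?thesis by (simp add: stiefel_proj_def S_def inner_diff_left)
qed

lemma continuous_on_stiefel_proj [continuous_intros]:
  assumes "continuous_on S f" "continuous_on S g"
  shows "continuous_on S (\<lambda>z. stiefel_proj (f z) (g z))"
  unfolding stiefel_proj_def
  by (intro continuous_intros assms bounded_bilinear.continuous_on[OF bounded_bilinear_matrix_mult]
      bounded_linear.continuous_on[OF bounded_linear_transpose])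

lemma closed_stiefel: "closed (stiefel :: (real^'k^'n) set)"
proof -
  have "continuous_on UNIV (\<lambda>V :: real^'k^'n. transpose V ** V)"
    by (intro continuous_intros bounded_bilinear.continuous_on[OF bounded_bilinear_matrix_mult]
      bounded_linear.continuous_on[OF bounded_linear_transpose])
  then have "closed ((\<lambda>V :: real^'k^'n. transpose V ** V) -` {mat 1})"
    by (simp add: closed_vimage)
  then show ?thesis by (simp add: stiefel_def vimage_def)
qed

text \<open>Differentiate the constant curve \<open>transpose (\<gamma> t) ** \<gamma> t\<close> by
  the product rule.\<close>

lemma velocity_stiefel_tangent:
  fixes \<gamma> :: "real \<Rightarrow> real^'k^'n"
  assumes "\<And>t. \<gamma> t \<in> stiefel" and "(\<gamma> has_vector_derivative Z) (at s)"
  shows "Z \<in> stiefel_tangent (\<gamma> s)"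
proof -
  have "((\<lambda>t. transpose (\<gamma> t) ** \<gamma> t) has_vector_derivative transpose (\<gamma> s) ** Z + transpose Z ** \<gamma> s) (at s)"
    using assms(2) bounded_linear.has_vector_derivative[OF bounded_linear_transpose assms(2)]
    by (intro bounded_bilinear.has_vector_derivative[OF bounded_bilinear_matrix_mult])
  moreover have "((\<lambda>t. transpose (\<gamma> t) ** \<gamma> t) has_vector_derivative 0) (at s)"
    using assms(1) by (simp add: stiefel_def)
  ultimately show ?thesis
    unfolding stiefel_tangent_def using vector_derivative_unique_at by blast
qed

lemma subspace_stiefel_tangent: "subspace (stiefel_tangent X)"
  unfolding subspace_def stiefel_tangent_def
  by (auto simp: bounded_bilinear.add_left[OF bounded_bilinear_matrix_mult] transpose_add
      bounded_bilinear.add_right[OF bounded_bilinear_matrix_mult]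
      bounded_bilinear.scaleR_left[OF bounded_bilinear_matrix_mult]
      bounded_bilinear.scaleR_right[OF bounded_bilinear_matrix_mult]
      bounded_bilinear.zero_left[OF bounded_bilinear_matrix_mult]
      bounded_bilinear.zero_right[OF bounded_bilinear_matrix_mult]
      linear_cmul[OF bounded_linear.linear[OF bounded_linear_transpose]]
      linear_0[OF bounded_linear.linear[OF bounded_linear_transpose]]
      simp flip: scaleR_add_right) (metis (no_types) add.assoc add.commute add.left_commute add_0)

section \<open>Locally uniform quadratic expansions\<close>

text \<open>\<open>F\<close> is the Euclidean gradient of \<open>f\<close>, and the first-order
  Taylor remainder is quadratic with one constant per ball. The notion is stable under sums and
  products, so it reaches polynomials without any second derivative.\<close>

definition quadratic_expansion :: "('a::euclidean_space \<Rightarrow> real) \<Rightarrow> ('a \<Rightarrow> 'a) \<Rightarrow> bool" where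
  "quadratic_expansion f F \<longleftrightarrow> continuous_on UNIV F \<and>
     (\<forall>B. \<exists>L\<ge>0. \<forall>x\<in>cball 0 B. \<forall>y\<in>cball 0 B. \<bar>f y - f x - inner (F x) (y - x)\<bar> \<le> L * (norm (y - x))\<^sup>2)"

lemma quadratic_expansionE:
  assumes "quadratic_expansion f F"
  obtains L where "L \<ge> 0"
    "\<And>x y. norm x \<le> B \<Longrightarrow> norm y \<le> B \<Longrightarrow> \<bar>f y - f x - inner (F x) (y - x)\<bar> \<le> L * (norm (y - x))\<^sup>2"
  using assms unfolding quadratic_expansion_def by (metis mem_cball_0)

lemma quadratic_expansion_continuous: "quadratic_expansion f F \<Longrightarrow> continuous_on UNIV F"
  by (simp add: quadratic_expansion_def)

text \<open>Used twice: for functions with a quadratic expansion and for curves obtained from a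
  retraction.\<close>

lemma has_derivative_quadratic_error:
  fixes f :: "'a::real_normed_vector \<Rightarrow> 'b::real_normed_vector"
  assumes "bounded_linear f'" and L: "L \<ge> 0"
    and err: "\<And>y. norm (y - x) \<le> 1 \<Longrightarrow> norm (f y - f x - f' (y - x)) \<le> L * (norm (y - x))\<^sup>2"
  shows "(f has_derivative f') (at x)"
  unfolding has_derivative_at_alt
proof (intro conjI allI impI)
  show "bounded_linear f'" by fact
  fix e :: real assume e: "e > 0"
  \<comment> \<open>The cap 1 keeps \<open>y\<close> where the error bound is available, and
    \<open>L + 1\<close> avoids a division by zero when \<open>L\<close> is 0.\<close>
  define d where "d = min 1 (e / (L + 1))"
  have d: "d > 0" "d \<le> 1" "L * d \<le> e"
  proof -
    show "d > 0" "d \<le> 1" using e L by (auto simp: d_def)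
    have "L * d \<le> L * (e / (L + 1))" by (intro mult_left_mono) (use L in \<open>auto simp: d_def\<close>)
    also have "\<dots> \<le> e" using e L by (simp add: field_simps)
    finally show "L * d \<le> e" .
  qed
  show "\<exists>d>0. \<forall>y. norm (y - x) < d \<longrightarrow> norm (f y - f x - f' (y - x)) \<le> e * norm (y - x)"
  proof (intro exI[of _ d] conjI allI impI d)
    fix y assume y: "norm (y - x) < d"
    have "norm (f y - f x - f' (y - x)) \<le> L * norm (y - x) * norm (y - x)"
      using err[of y] y d by (simp add: power2_eq_square mult.assoc)
    also have "\<dots> \<le> e * norm (y - x)"
    proof (intro mult_right_mono)
      have "L * norm (y - x) \<le> L * d" using y L by (intro mult_left_mono) auto
      then show "L * norm (y - x) \<le> e" using d by linarith
    qed simp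
    finally show "norm (f y - f x - f' (y - x)) \<le> e * norm (y - x)" .
  qed
qed

lemma quadratic_expansion_has_derivative:
  assumes "quadratic_expansion f F"
  shows "(f has_derivative inner (F x)) (at x)"
proof -
  obtain L where L: "L \<ge> 0"
    "\<And>x' y. norm x' \<le> norm x + 1 \<Longrightarrow> norm y \<le> norm x + 1 \<Longrightarrow> \<bar>f y - f x' - inner (F x') (y - x')\<bar> \<le> L * (norm (y - x'))\<^sup>2"
    using quadratic_expansionE[OF assms] by blast
  show ?thesis
  proof (rule has_derivative_quadratic_error[OF bounded_linear_inner_right L(1)])
    fix y assume "norm (y - x) \<le> 1"
    then have "norm y \<le> norm x + 1" using norm_triangle_sub[of y x] by linarith
    then show "norm (f y - f x - inner (F x) (y - x)) \<le> L * (norm (y - x))\<^sup>2"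
      using L(2)[of x y] by simp
  qed
qed

lemma quadratic_expansion_const: "quadratic_expansion (\<lambda>_. c) (\<lambda>_. 0)"
  unfolding quadratic_expansion_def by (auto intro: exI[of _ 0])

text \<open>The expansion is exact, with the Riesz vector of \<open>f\<close> as gradient.\<close>

lemma quadratic_expansion_linear:
  fixes f :: "'a::euclidean_space \<Rightarrow> real"
  assumes "linear f"
  shows "\<exists>F. quadratic_expansion f F"
proof -
  have "f y - f x - inner (adjoint f 1) (y - x) = 0" for x y
    using adjoint_works[OF assms, of "y - x" 1]
    by (simp add: inner_commute linear_diff[OF assms])
  then have "quadratic_expansion f (\<lambda>_. adjoint f 1)"
    unfolding quadratic_expansion_def by (auto intro: exI[of _ 0])
  then show ?thesis by blast
qed

lemma quadratic_expansion_add: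
  fixes f g :: "'a::euclidean_space \<Rightarrow> real"
  assumes "quadratic_expansion f F" "quadratic_expansion g G"
  shows "quadratic_expansion (\<lambda>x. f x + g x) (\<lambda>x. F x + G x)"
  unfolding quadratic_expansion_def
proof (intro conjI allI)
  show "continuous_on UNIV (\<lambda>x. F x + G x)"
    using assms by (intro continuous_intros quadratic_expansion_continuous)
  fix B
  obtain L where L: "L \<ge> 0"
    "\<And>x y. norm x \<le> B \<Longrightarrow> norm y \<le> B \<Longrightarrow> \<bar>f y - f x - inner (F x) (y - x)\<bar> \<le> L * (norm (y - x))\<^sup>2"
    using quadratic_expansionE[OF assms(1)] by blast
  obtain K where K: "K \<ge> 0"
    "\<And>x y. norm x \<le> B \<Longrightarrow> norm y \<le> B \<Longrightarrow> \<bar>g y - g x - inner (G x) (y - x)\<bar> \<le> K * (norm (y - x))\<^sup>2"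
    using quadratic_expansionE[OF assms(2)] by blast
  show "\<exists>L\<ge>0. \<forall>x\<in>cball 0 B. \<forall>y\<in>cball 0 B.
     \<bar>f y + g y - (f x + g x) - inner (F x + G x) (y - x)\<bar> \<le> L * (norm (y - x))\<^sup>2"
  proof (intro exI[of _ "L + K"] conjI ballI)
    fix x y :: 'a assume "x \<in> cball 0 B" "y \<in> cball 0 B"
    then have "norm x \<le> B" "norm y \<le> B" by auto
    from L(2)[OF this] K(2)[OF this]
    show "\<bar>f y + g y - (f x + g x) - inner (F x + G x) (y - x)\<bar> \<le> (L + K) * (norm (y - x))\<^sup>2"
      unfolding distrib_right inner_add_left by linarith
  qed (use L K in simp)
qed

lemma continuous_on_bounded_cball:
  fixes F :: "'a::euclidean_space \<Rightarrow> 'b::real_normed_vector"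
  assumes "continuous_on UNIV F"
  obtains C where "C \<ge> 0" "\<And>x. norm x \<le> B \<Longrightarrow> norm (F x) \<le> C"
proof -
  have "bounded (F ` cball 0 B)"
    by (intro compact_imp_bounded compact_continuous_image continuous_on_subset[OF assms]) auto
  then obtain C where "C > 0" "\<And>x. norm x \<le> B \<Longrightarrow> norm (F x) \<le> C"
    by (auto simp: bounded_pos)
  then show ?thesis using that[of C] by simp
qed

lemma quadratic_expansion_continuous_fun:
  assumes "quadratic_expansion f F"
  shows "continuous_on UNIV f"
  by (rule has_derivative_continuous_on) (rule quadratic_expansion_has_derivative[OF assms])

text \<open>Cauchy-Schwarz bounds the linear term, and in the quadratic one a factor is bounded by
  the diameter of the ball. The absolute value of \<open>B\<close> keeps the constant nonnegative
  when \<open>B\<close> is negative and the ball is empty.\<close>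

lemma quadratic_expansion_lipschitz:
  assumes "quadratic_expansion f F"
  obtains C where "C \<ge> 0" "\<And>x y. norm x \<le> B \<Longrightarrow> norm y \<le> B \<Longrightarrow> \<bar>f y - f x\<bar> \<le> C * norm (y - x)"
proof -
  obtain L where L: "L \<ge> 0"
    "\<And>x y. norm x \<le> B \<Longrightarrow> norm y \<le> B \<Longrightarrow> \<bar>f y - f x - inner (F x) (y - x)\<bar> \<le> L * (norm (y - x))\<^sup>2"
    using quadratic_expansionE[OF assms(1)] by blast
  obtain C where C: "C \<ge> 0" "\<And>x. norm x \<le> B \<Longrightarrow> norm (F x) \<le> C"
    using continuous_on_bounded_cball[OF quadratic_expansion_continuous[OF assms]] by blast
  have main: "\<bar>f y - f x\<bar> \<le> (C + L * (2 * \<bar>B\<bar>)) * norm (y - x)" if B: "norm x \<le> B" "norm y \<le> B" for x y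
  proof -
    have "\<bar>inner (F x) (y - x)\<bar> \<le> norm (F x) * norm (y - x)" by (rule Cauchy_Schwarz_ineq2)
    also have "\<dots> \<le> C * norm (y - x)" using C(2)[OF B(1)] by (intro mult_right_mono) auto
    finally have 1: "\<bar>inner (F x) (y - x)\<bar> \<le> C * norm (y - x)" .
    have "norm (y - x) \<le> 2 * \<bar>B\<bar>" using norm_triangle_ineq4[of y x] B by linarith
    then have "(norm (y - x))\<^sup>2 \<le> 2 * \<bar>B\<bar> * norm (y - x)"
      unfolding power2_eq_square by (rule mult_right_mono) simp
    then have "L * (norm (y - x))\<^sup>2 \<le> L * (2 * \<bar>B\<bar>) * norm (y - x)"
      using L by (simp add: mult.assoc mult_left_mono)
    then show ?thesis using 1 L(2)[OF B] unfolding distrib_right by linarith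
  qed
  show ?thesis by (rule that[of "C + L * (2 * \<bar>B\<bar>)"]) (use C L main in auto)
qed

text \<open>The remainder of a product is the product of the two increments, of second order by the
  Lipschitz bounds, plus each remainder times the value of the other factor.\<close>

lemma quadratic_expansion_mult:
  fixes f g :: "'a::euclidean_space \<Rightarrow> real"
  assumes f: "quadratic_expansion f F" and g: "quadratic_expansion g G"
  shows "quadratic_expansion (\<lambda>x. f x * g x) (\<lambda>x. f x *\<^sub>R G x + g x *\<^sub>R F x)"
  unfolding quadratic_expansion_def
proof (intro conjI allI)
  show "continuous_on UNIV (\<lambda>x. f x *\<^sub>R G x + g x *\<^sub>R F x)"
    using assms by (intro continuous_intros) (auto dest: quadratic_expansion_continuous quadratic_expansion_continuous_fun)
  fix B
  obtain L where L: "L \<ge> 0"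
    "\<And>x y. norm x \<le> B \<Longrightarrow> norm y \<le> B \<Longrightarrow> \<bar>f y - f x - inner (F x) (y - x)\<bar> \<le> L * (norm (y - x))\<^sup>2"
    using quadratic_expansionE[OF f] by blast
  obtain K where K: "K \<ge> 0"
    "\<And>x y. norm x \<le> B \<Longrightarrow> norm y \<le> B \<Longrightarrow> \<bar>g y - g x - inner (G x) (y - x)\<bar> \<le> K * (norm (y - x))\<^sup>2"
    using quadratic_expansionE[OF g] by blast
  obtain c where c: "c \<ge> 0" "\<And>x. norm x \<le> B \<Longrightarrow> norm (f x) \<le> c"
    using continuous_on_bounded_cball[OF quadratic_expansion_continuous_fun[OF f]] by blast
  obtain d where d: "d \<ge> 0" "\<And>x. norm x \<le> B \<Longrightarrow> norm (g x) \<le> d"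
    using continuous_on_bounded_cball[OF quadratic_expansion_continuous_fun[OF g]] by blast
  obtain p where p: "p \<ge> 0" "\<And>x y. norm x \<le> B \<Longrightarrow> norm y \<le> B \<Longrightarrow> \<bar>f y - f x\<bar> \<le> p * norm (y - x)"
    using quadratic_expansion_lipschitz[OF f] by blast
  obtain q where q: "q \<ge> 0" "\<And>x y. norm x \<le> B \<Longrightarrow> norm y \<le> B \<Longrightarrow> \<bar>g y - g x\<bar> \<le> q * norm (y - x)"
    using quadratic_expansion_lipschitz[OF g] by blast
  show "\<exists>L\<ge>0. \<forall>x\<in>cball 0 B. \<forall>y\<in>cball 0 B.
     \<bar>f y * g y - f x * g x - inner (f x *\<^sub>R G x + g x *\<^sub>R F x) (y - x)\<bar> \<le> L * (norm (y - x))\<^sup>2"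
  proof (intro exI[of _ "p * q + c * K + d * L"] conjI ballI)
    fix x y :: 'a assume "x \<in> cball 0 B" "y \<in> cball 0 B"
    then have B: "norm x \<le> B" "norm y \<le> B" by auto
    let ?h = "norm (y - x)"
    let ?rf = "f y - f x - inner (F x) (y - x)" and ?rg = "g y - g x - inner (G x) (y - x)"
    have "f y * g y - f x * g x - inner (f x *\<^sub>R G x + g x *\<^sub>R F x) (y - x) =
      (f y - f x) * (g y - g x) + f x * ?rg + g x * ?rf"
      by (simp add: inner_add_left algebra_simps)
    moreover have "\<bar>(f y - f x) * (g y - g x)\<bar> \<le> (p * ?h) * (q * ?h)"
      unfolding abs_mult using p q B by (intro mult_mono) auto
    moreover have "\<bar>f x * ?rg\<bar> \<le> c * (K * ?h\<^sup>2)"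
      unfolding abs_mult using c K B by (intro mult_mono) auto
    moreover have "\<bar>g x * ?rf\<bar> \<le> d * (L * ?h\<^sup>2)"
      unfolding abs_mult using d L B by (intro mult_mono) auto
    moreover have "(p * q + c * K + d * L) * ?h\<^sup>2 = (p * ?h) * (q * ?h) + c * (K * ?h\<^sup>2) + d * (L * ?h\<^sup>2)"
      by (simp add: algebra_simps power2_eq_square)
    ultimately show "\<bar>f y * g y - f x * g x - inner (f x *\<^sub>R G x + g x *\<^sub>R F x) (y - x)\<bar>
      \<le> (p * q + c * K + d * L) * ?h\<^sup>2"
      by linarith
  qed (use p q c d L K in simp)
qed

lemma quadratic_expansion_sum:
  assumes "\<And>i. i \<in> I \<Longrightarrow> \<exists>F. quadratic_expansion (f i) F"
  shows "\<exists>F. quadratic_expansion (\<lambda>x. \<Sum>i\<in>I. f i x) F"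
  using assms
proof (induction I rule: infinite_finite_induct)
  case (insert i I)
  then obtain F G where "quadratic_expansion (f i) F" "quadratic_expansion (\<lambda>x. \<Sum>i\<in>I. f i x) G" by blast
  from quadratic_expansion_add[OF this] show ?case using insert by auto
qed (auto intro: quadratic_expansion_const)

section \<open>Descent with Armijo steps\<close>

text \<open>The chain rule shows that \<open>g\<close> has the defining property. For uniqueness,
  the difference of two candidates is itself tangent, hence the velocity of some curve; testing
  along that curve shows it to be orthogonal to itself.\<close>

lemma riemannian_gradient_eq:
  assumes f: "(f has_derivative inner v) (at x)"
    and g: "g \<in> T x" "\<And>\<xi>. \<xi> \<in> T x \<Longrightarrow> inner g \<xi> = inner v \<xi>"
    and T: "subspace (T x)"
    and velocity: "\<And>\<gamma> \<xi>. (\<And>t. \<gamma> t \<in> M) \<Longrightarrow> \<gamma> 0 = x \<Longrightarrow>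
      (\<gamma> has_vector_derivative \<xi>) (at (0::real)) \<Longrightarrow> \<xi> \<in> T x"
    and curve: "\<And>\<xi>. \<xi> \<in> T x \<Longrightarrow>
      \<exists>\<gamma>. (\<forall>t. \<gamma> t \<in> M) \<and> \<gamma> 0 = x \<and> (\<gamma> has_vector_derivative \<xi>) (at (0::real))"
  shows "riemannian_gradient M T f x = g"
  unfolding riemannian_gradient_def
proof (rule the_equality)
  have *: "((\<lambda>t. f (\<gamma> t)) has_real_derivative inner g \<xi>) (at 0)"
    if "\<forall>t. \<gamma> t \<in> M" "\<gamma> 0 = x" "(\<gamma> has_vector_derivative \<xi>) (at 0)" for \<gamma> \<xi>
  proof -
    have "\<xi> \<in> T x" using velocity that by blast
    then have "inner g \<xi> = inner v \<xi>" by (rule g)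
    moreover have "((\<lambda>t. f (\<gamma> t)) has_vector_derivative inner v \<xi>) (at 0)"
      using vector_derivative_diff_chain_within[of \<gamma> \<xi> 0 UNIV f "inner v"] that f
      by (simp add: o_def has_derivative_at_withinI)
    ultimately show ?thesis by (simp add: has_real_derivative_iff_has_vector_derivative)
  qed
  then show "g \<in> T x \<and> (\<forall>\<gamma> \<xi>. (\<forall>t. \<gamma> t \<in> M) \<and> \<gamma> 0 = x \<and> (\<gamma> has_vector_derivative \<xi>) (at 0) \<longrightarrow>
      ((\<lambda>t. f (\<gamma> t)) has_real_derivative inner g \<xi>) (at 0))"
    using g(1) by blast
  fix g' assume g': "g' \<in> T x \<and> (\<forall>\<gamma> \<xi>. (\<forall>t. \<gamma> t \<in> M) \<and> \<gamma> 0 = x \<and> (\<gamma> has_vector_derivative \<xi>) (at 0) \<longrightarrow>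
      ((\<lambda>t. f (\<gamma> t)) has_real_derivative inner g' \<xi>) (at 0))"
  then have "g' - g \<in> T x" using g(1) T by (simp add: subspace_diff)
  then obtain \<gamma> where \<gamma>: "\<forall>t. \<gamma> t \<in> M" "\<gamma> 0 = x" "(\<gamma> has_vector_derivative (g' - g)) (at (0::real))"
    using curve by blast
  then have "inner g' (g' - g) = inner g (g' - g)"
    using g' * DERIV_unique by blast
  then have "inner (g' - g) (g' - g) = 0" by (simp add: inner_diff_left)
  then show "g' = g" by simp
qed

text \<open>Supplies the curves that \<open>riemannian_gradient_eq\<close> asks for. Quadratic
  closeness to \<open>x + \<xi>\<close> already gives differentiability at 0, with no regularity of
  \<open>R\<close> assumed elsewhere.\<close>

lemma second_order_retraction_curve:
  assumes T: "subspace T"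
    and R: "\<And>\<xi>. \<xi> \<in> T \<Longrightarrow> norm (R \<xi> - (x + \<xi>)) \<le> c * (norm \<xi>)\<^sup>2"
    and \<xi>: "\<xi> \<in> T" and c: "c \<ge> 0"
  shows "R 0 = x" "((\<lambda>t. R (t *\<^sub>R \<xi>)) has_vector_derivative \<xi>) (at 0)"
proof -
  show R0: "R 0 = x" using R[of 0] T by (simp add: subspace_0)
  show "((\<lambda>t. R (t *\<^sub>R \<xi>)) has_vector_derivative \<xi>) (at 0)"
    unfolding has_vector_derivative_def
  proof (rule has_derivative_quadratic_error[where L = "c * (norm \<xi>)\<^sup>2"])
    fix t :: real
    show "norm (R (t *\<^sub>R \<xi>) - R (0 *\<^sub>R \<xi>) - (t - 0) *\<^sub>R \<xi>) \<le> c * (norm \<xi>)\<^sup>2 * (norm (t - 0))\<^sup>2"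
      using R[of "t *\<^sub>R \<xi>"] T \<xi> by (simp add: R0 subspace_scale diff_diff_eq power_mult_distrib mult_ac)
  qed (use c in \<open>auto intro: bounded_linear_scaleR_left\<close>)
qed

text \<open>Every trial step of length at most \<open>(1 - \<iota>) / C\<close> passes the test, so
  the search ends. Either the first trial \<open>\<alpha>\<close> passes, or the trial before the
  accepted one failed and so was longer than this threshold; the accepted step is
  \<open>\<beta>\<close> times that trial.\<close>

lemma armijo_step_bounds:
  assumes \<alpha>: "0 < \<alpha>" and \<beta>: "0 < \<beta>" "\<beta> < 1" and \<iota>: "\<iota> < 1" and C: "0 < C"
    and g: "riemannian_gradient M T f x = g"
    and decrease: "\<And>s. 0 \<le> s \<Longrightarrow> s \<le> \<alpha> \<Longrightarrow>
      f x - f (R x (s *\<^sub>R (- g))) \<ge> s * (norm g)\<^sup>2 - C * s\<^sup>2 * (norm g)\<^sup>2"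
    and \<tau>: "\<tau> = armijo_step M T R f \<alpha> \<beta> \<iota> x (- g)"
  shows "f x - f (R x (- \<tau> *\<^sub>R g)) \<ge> \<iota> * \<tau> * (norm g)\<^sup>2" "\<tau> \<ge> min \<alpha> (\<beta> * (1 - \<iota>) / C)"
proof -
  \<comment> \<open>This is the Armijo test: in the direction \<open>- g\<close> its minus sign
    cancels.\<close>
  define P where "P N \<longleftrightarrow> f x - f (R x ((\<beta> ^ N * \<alpha>) *\<^sub>R (- g))) \<ge> \<iota> * (\<beta> ^ N * \<alpha>) * (norm g)\<^sup>2" for N
  define N0 where "N0 = (LEAST N. P N)"
  have \<tau>_eq: "\<tau> = \<beta> ^ N0 * \<alpha>"
    unfolding \<tau> armijo_step_def N0_def P_def g by (simp add: power2_norm_eq_inner mult.assoc)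
  have P_small: "P N" if "\<beta> ^ N * \<alpha> \<le> (1 - \<iota>) / C" for N
  proof -
    define s where "s = \<beta> ^ N * \<alpha>"
    have s: "0 \<le> s" "s \<le> \<alpha>" "s \<le> (1 - \<iota>) / C"
      using \<alpha> \<beta> that by (auto simp: s_def intro!: mult_left_le_one_le power_le_one)
    then have "\<iota> \<le> 1 - C * s" using C by (simp add: field_simps)
    then have "\<iota> * (s * (norm g)\<^sup>2) \<le> (1 - C * s) * (s * (norm g)\<^sup>2)"
      using s by (intro mult_right_mono) auto
    also have "\<dots> = s * (norm g)\<^sup>2 - C * s\<^sup>2 * (norm g)\<^sup>2" by (simp add: algebra_simps power2_eq_square)
    also have "\<dots> \<le> f x - f (R x (s *\<^sub>R (- g)))" by (rule decrease[OF s(1,2)])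
    finally show ?thesis unfolding P_def s_def by (simp add: mult.assoc)
  qed
  have "(\<lambda>N. \<beta> ^ N * \<alpha>) \<longlonglongrightarrow> 0 * \<alpha>"
    by (intro tendsto_intros LIMSEQ_power_zero) (use \<beta> in auto)
  moreover have "(1 - \<iota>) / C > 0 * \<alpha>" using \<iota> C by simp
  ultimately have "\<forall>\<^sub>F N in sequentially. \<beta> ^ N * \<alpha> < (1 - \<iota>) / C" by (rule order_tendstoD)
  then obtain N where "\<beta> ^ N * \<alpha> < (1 - \<iota>) / C" by (auto simp: eventually_sequentially)
  then have "P N0" unfolding N0_def using P_small by (meson LeastI less_imp_le)
  then show "f x - f (R x (- \<tau> *\<^sub>R g)) \<ge> \<iota> * \<tau> * (norm g)\<^sup>2" unfolding P_def \<tau>_eq by simp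
  show "\<tau> \<ge> min \<alpha> (\<beta> * (1 - \<iota>) / C)"
  proof (cases N0)
    case 0
    then show ?thesis by (simp add: \<tau>_eq)
  next
    case (Suc n)
    then have "\<not> P n" unfolding N0_def using not_less_Least[of n P] by simp
    then have "(1 - \<iota>) / C \<le> \<beta> ^ n * \<alpha>" using P_small by force
    then have "\<beta> * ((1 - \<iota>) / C) \<le> \<beta> * (\<beta> ^ n * \<alpha>)" using \<beta> by (intro mult_left_mono) auto
    then show ?thesis by (simp add: \<tau>_eq Suc mult.assoc min.coboundedI2)
  qed
qed

text \<open>Here \<open>y\<close> stands for the retracted point, and the condition on
  \<open>inner (F x) g\<close> holds when \<open>g\<close> is the tangential projection of
  \<open>F x\<close>. The linear Taylor term provides the decrease; the retraction error and the
  Taylor remainder are both of order \<open>s\<^sup>2 * (norm g)\<^sup>2\<close>.\<close>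

lemma retraction_descent:
  fixes f :: "'a::euclidean_space \<Rightarrow> real"
  assumes f: "quadratic_expansion f F" and c: "c \<ge> 0" and \<alpha>: "\<alpha> > 0"
  obtains C where "C > 0"
    "\<And>x y g s. norm x \<le> B \<Longrightarrow> norm g \<le> B \<Longrightarrow> inner (F x) g = (norm g)\<^sup>2 \<Longrightarrow> 0 \<le> s \<Longrightarrow> s \<le> \<alpha> \<Longrightarrow>
      norm (y - (x - s *\<^sub>R g)) \<le> c * (s * norm g)\<^sup>2 \<Longrightarrow>
      f x - f y \<ge> s * (norm g)\<^sup>2 - C * s\<^sup>2 * (norm g)\<^sup>2"
proof -
  \<comment> \<open>\<open>D\<close> is chosen so that \<open>norm (y - x)\<close> is at most
    \<open>D * (s * norm g)\<close>, and \<open>B'\<close> is the radius of a ball that contains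
    both \<open>x\<close> and \<open>y\<close>.\<close>
  define D where "D = 1 + c * \<alpha> * \<bar>B\<bar>"
  define B' where "B' = \<bar>B\<bar> + D * (\<alpha> * \<bar>B\<bar>)"
  have D: "D \<ge> 1" using c \<alpha> by (simp add: D_def)
  obtain L where L: "L \<ge> 0"
    "\<And>x y. norm x \<le> B' \<Longrightarrow> norm y \<le> B' \<Longrightarrow> \<bar>f y - f x - inner (F x) (y - x)\<bar> \<le> L * (norm (y - x))\<^sup>2"
    using quadratic_expansionE[OF f] by blast
  obtain K where K: "K \<ge> 0" "\<And>x. norm x \<le> B \<Longrightarrow> norm (F x) \<le> K"
    using continuous_on_bounded_cball[OF quadratic_expansion_continuous[OF f]] by blast
  \<comment> \<open>The summands account for the retraction error in the linear term and for the
    Taylor remainder; the final 1 makes \<open>C\<close> positive.\<close>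
  define C where "C = K * c + L * D\<^sup>2 + 1"
  show ?thesis
  proof (rule that[of C])
    show "C > 0" using K c L by (simp add: C_def add_nonneg_pos)
    fix x y g s assume x: "norm x \<le> B" and g: "norm g \<le> B" "inner (F x) g = (norm g)\<^sup>2"
      and s: "0 \<le> s" "s \<le> \<alpha>" and y: "norm (y - (x - s *\<^sub>R g)) \<le> c * (s * norm g)\<^sup>2"
    define e where "e = y - (x - s *\<^sub>R g)"
    have yx: "y - x = e - s *\<^sub>R g" by (simp add: e_def)
    have sg: "s * norm g \<le> \<alpha> * \<bar>B\<bar>" "0 \<le> s * norm g"
      using s g by (auto intro!: mult_mono)
    have "(s * norm g)\<^sup>2 \<le> (\<alpha> * \<bar>B\<bar>) * (s * norm g)"
      unfolding power2_eq_square using sg by (intro mult_right_mono)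
    then have "c * (s * norm g)\<^sup>2 \<le> c * (\<alpha> * \<bar>B\<bar>) * (s * norm g)"
      unfolding mult.assoc[of c] using c by (intro mult_left_mono)
    then have "norm (y - x) \<le> D * (s * norm g)"
      unfolding yx using y norm_triangle_ineq4[of e "s *\<^sub>R g"] s by (simp add: D_def e_def algebra_simps)
    moreover from this have "(norm (y - x))\<^sup>2 \<le> (D * (s * norm g))\<^sup>2"
      by (intro power_mono) auto
    moreover have "norm y \<le> B'"
    proof -
      have "D * (s * norm g) \<le> D * (\<alpha> * \<bar>B\<bar>)" using sg D by (intro mult_left_mono) auto
      then show ?thesis using calculation(1) x norm_triangle_sub[of y x] unfolding B'_def by linarith
    qed
    moreover have "norm x \<le> B'"
    proof -
      have "0 \<le> D * (\<alpha> * \<bar>B\<bar>)" using D \<alpha> by simp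
      then show ?thesis using x unfolding B'_def by linarith
    qed
    ultimately have "f y - f x - inner (F x) (y - x) \<le> L * (D * (s * norm g))\<^sup>2"
      using L by (smt (verit) mult_left_mono)
    moreover have "inner (F x) (y - x) \<le> K * (c * (s * norm g)\<^sup>2) - s * (norm g)\<^sup>2"
    proof -
      have "inner (F x) e \<le> norm (F x) * norm e" by (rule norm_cauchy_schwarz)
      also have "\<dots> \<le> K * (c * (s * norm g)\<^sup>2)"
        using K(2)[OF x] y K(1) unfolding e_def by (intro mult_mono) auto
      finally show ?thesis using g(2) by (simp add: yx inner_diff_right)
    qed
    moreover have "0 \<le> s\<^sup>2 * (norm g)\<^sup>2" by simp
    moreover have "C * s\<^sup>2 * (norm g)\<^sup>2 =
        K * (c * (s * norm g)\<^sup>2) + L * (D * (s * norm g))\<^sup>2 + s\<^sup>2 * (norm g)\<^sup>2"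
      by (simp add: C_def power_mult_distrib algebra_simps)
    ultimately show "f x - f y \<ge> s * (norm g)\<^sup>2 - C * s\<^sup>2 * (norm g)\<^sup>2" by linarith
  qed
qed

text \<open>Separates the convergence argument from the matrices: the manifold enters only through
  its tangent spaces, velocities of curves and a second-order retraction. The field \<open>g\<close>
  makes the gradient explicit, so that its continuity can be used.\<close>

lemma armijo_descent_converges:
  fixes M :: "'a::euclidean_space set" and T :: "'a \<Rightarrow> 'a set" and S :: "nat \<Rightarrow> 'a"
  assumes M: "closed M" and T: "\<And>x. x \<in> M \<Longrightarrow> subspace (T x)"
    and velocity: "\<And>\<gamma> \<xi>. (\<And>t. \<gamma> t \<in> M) \<Longrightarrow>
      (\<gamma> has_vector_derivative \<xi>) (at (0::real)) \<Longrightarrow> \<xi> \<in> T (\<gamma> 0)"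
    and R: "\<And>x \<xi>. x \<in> M \<Longrightarrow> \<xi> \<in> T x \<Longrightarrow> R x \<xi> \<in> M"
      "\<And>x \<xi>. x \<in> M \<Longrightarrow> \<xi> \<in> T x \<Longrightarrow> norm (R x \<xi> - (x + \<xi>)) \<le> c * (norm \<xi>)\<^sup>2" and c: "c \<ge> 0"
    and f: "quadratic_expansion f F"
    and g: "continuous_on M g" "\<And>x. x \<in> M \<Longrightarrow> g x \<in> T x"
      "\<And>x \<xi>. x \<in> M \<Longrightarrow> \<xi> \<in> T x \<Longrightarrow> inner (g x) \<xi> = inner (F x) \<xi>"
    and bdd: "bounded {x \<in> M. f x \<le> f (S 0)}"
    and \<alpha>: "0 < \<alpha>" and \<beta>: "0 < \<beta>" "\<beta> < 1" and \<iota>: "0 < \<iota>" "\<iota> < 1"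
    and S: "\<And>t. S t \<in> M"
      "\<And>t. f (S (Suc t)) \<le> f (R (S t) (- armijo_step M T R f \<alpha> \<beta> \<iota> (S t)
          (- riemannian_gradient M T f (S t)) *\<^sub>R riemannian_gradient M T f (S t)))"
  shows "(\<exists>r l. strict_mono r \<and> (S \<circ> r) \<longlonglongrightarrow> l \<and> critical_point M T f l) \<and>
    (\<lambda>t. norm (riemannian_gradient M T f (S t))) \<longlonglongrightarrow> 0"
proof -
  have grad: "riemannian_gradient M T f x = g x" if x: "x \<in> M" for x
  proof (rule riemannian_gradient_eq)
    show "(f has_derivative inner (F x)) (at x)" by (rule quadratic_expansion_has_derivative[OF f])
    show "g x \<in> T x" "\<And>\<xi>. \<xi> \<in> T x \<Longrightarrow> inner (g x) \<xi> = inner (F x) \<xi>" "subspace (T x)"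
      using g T x by auto
    show "\<xi> \<in> T x" if "\<And>t. \<gamma> t \<in> M" "\<gamma> 0 = x" "(\<gamma> has_vector_derivative \<xi>) (at 0)" for \<gamma> \<xi>
      using velocity[OF that(1,3)] that(2) by simp
    show "\<exists>\<gamma>. (\<forall>t. \<gamma> t \<in> M) \<and> \<gamma> 0 = x \<and> (\<gamma> has_vector_derivative \<xi>) (at (0::real))" if \<xi>: "\<xi> \<in> T x" for \<xi>
      using second_order_retraction_curve[OF T[OF x] R(2)[OF x] \<xi> c] R(1)[OF x] subspace_scale[OF T[OF x] \<xi>]
      by (intro exI[of _ "\<lambda>t. R x (t *\<^sub>R \<xi>)"]) auto
  qed
  define K where "K = {x \<in> M. f x \<le> f (S 0)}"
  have "closed {x. f x \<le> f (S 0)}"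
    using quadratic_expansion_continuous_fun[OF f] by (intro closed_Collect_le continuous_intros)
  then have "closed (M \<inter> {x. f x \<le> f (S 0)})" using M by blast
  then have K: "compact K"
    unfolding K_def using bdd by (auto simp: compact_eq_bounded_closed Collect_conj_eq)
  have "bounded (g ` K)"
    using K g(1) by (intro compact_imp_bounded compact_continuous_image) (auto intro: continuous_on_subset simp: K_def)
  \<comment> \<open>One radius has to serve for both the points and their gradients in
    \<open>retraction_descent\<close>.\<close>
  then have "bounded (K \<union> g ` K)" using compact_imp_bounded[OF K] by simp
  then obtain B where "\<And>x. x \<in> K \<union> g ` K \<Longrightarrow> norm x \<le> B"
    by (meson bounded_iff)
  then have B: "norm x \<le> B" "norm (g x) \<le> B" if "x \<in> K" for x using that by blast+
  obtain C where C: "C > 0"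
    "\<And>x y g s. norm x \<le> B \<Longrightarrow> norm g \<le> B \<Longrightarrow> inner (F x) g = (norm g)\<^sup>2 \<Longrightarrow> 0 \<le> s \<Longrightarrow> s \<le> \<alpha> \<Longrightarrow>
      norm (y - (x - s *\<^sub>R g)) \<le> c * (s * norm g)\<^sup>2 \<Longrightarrow>
      f x - f y \<ge> s * (norm g)\<^sup>2 - C * s\<^sup>2 * (norm g)\<^sup>2"
    using retraction_descent[OF f c \<alpha>] by blast
  define \<tau>0 where "\<tau>0 = min \<alpha> (\<beta> * (1 - \<iota>) / C)"
  have \<tau>0: "\<tau>0 > 0" using \<alpha> \<beta> \<iota> C by (simp add: \<tau>0_def)
  \<comment> \<open>The constants are valid on \<open>K\<close> only, so the decrease is first shown
    conditionally; it then carries the induction that keeps all iterates in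
    \<open>K\<close>.\<close>
  have step: "f (S (Suc t)) \<le> f (S t) - \<iota> * \<tau>0 * (norm (g (S t)))\<^sup>2" if "S t \<in> K" for t
  proof -
    define \<tau> where "\<tau> = armijo_step M T R f \<alpha> \<beta> \<iota> (S t) (- g (S t))"
    have desc: "f (S t) - f (R (S t) (s *\<^sub>R (- g (S t)))) \<ge>
        s * (norm (g (S t)))\<^sup>2 - C * s\<^sup>2 * (norm (g (S t)))\<^sup>2" if s: "0 \<le> s" "s \<le> \<alpha>" for s
    proof (rule C(2)[OF B[OF \<open>S t \<in> K\<close>] _ s])
      show "inner (F (S t)) (g (S t)) = (norm (g (S t)))\<^sup>2"
        using g(3)[OF S(1) g(2)[OF S(1)]] by (simp add: power2_norm_eq_inner)
      have "s *\<^sub>R (- g (S t)) \<in> T (S t)"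
        using T[OF S(1)] g(2)[OF S(1)] by (intro subspace_scale subspace_neg)
      from R(2)[OF S(1) this]
      show "norm (R (S t) (s *\<^sub>R (- g (S t))) - (S t - s *\<^sub>R g (S t))) \<le> c * (s * norm (g (S t)))\<^sup>2"
        using s by simp
    qed
    note ab = armijo_step_bounds[OF \<alpha> \<beta> \<iota>(2) C(1) grad[OF S(1)] desc \<tau>_def]
    have "f (S (Suc t)) \<le> f (R (S t) (- \<tau> *\<^sub>R g (S t)))"
      using S(2)[of t] by (simp add: grad[OF S(1)] \<tau>_def)
    moreover have "\<iota> * \<tau>0 * (norm (g (S t)))\<^sup>2 \<le> \<iota> * \<tau> * (norm (g (S t)))\<^sup>2"
      using ab(2) \<iota> unfolding \<tau>0_def[symmetric] by (intro mult_right_mono mult_left_mono) auto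
    ultimately show ?thesis using ab(1) by linarith
  qed
  have SK: "S t \<in> K" for t
  proof (induction t)
    case 0
    then show ?case using S by (simp add: K_def)
  next
    case (Suc t)
    have "0 \<le> \<iota> * \<tau>0 * (norm (g (S t)))\<^sup>2" using \<iota> \<tau>0 by simp
    then show ?case using step[OF Suc] Suc S by (simp add: K_def)
  qed
  have "decseq (\<lambda>t. f (S t))"
  proof (rule decseq_SucI)
    fix t
    have "0 \<le> \<iota> * \<tau>0 * (norm (g (S t)))\<^sup>2" using \<iota> \<tau>0 by simp
    then show "f (S (Suc t)) \<le> f (S t)" using step[OF SK[of t]] by linarith
  qed
  moreover have "bounded (f ` K)"
    using K quadratic_expansion_continuous_fun[OF f]
    by (intro compact_imp_bounded compact_continuous_image) (auto intro: continuous_on_subset)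
  then have "Bseq (\<lambda>t. f (S t))"
    unfolding Bseq_eq_bounded by (rule bounded_subset) (use SK in auto)
  ultimately have "convergent (\<lambda>t. f (S t))"
    by (simp add: Bseq_monoseq_convergent decseq_imp_monoseq)
  then obtain L where L: "(\<lambda>t. f (S t)) \<longlonglongrightarrow> L" by (auto simp: convergent_def)
  \<comment> \<open>Consecutive differences of the convergent values tend to 0, and up to a constant
    factor they dominate the squared gradient norms.\<close>
  have "(\<lambda>t. (f (S t) - f (S (Suc t))) / (\<iota> * \<tau>0)) \<longlonglongrightarrow> (L - L) / (\<iota> * \<tau>0)"
    using \<iota> \<tau>0 by (intro tendsto_intros L LIMSEQ_Suc[OF L]) auto
  then have "(\<lambda>t. (f (S t) - f (S (Suc t))) / (\<iota> * \<tau>0)) \<longlonglongrightarrow> 0" by simp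
  then have "(\<lambda>t. (norm (g (S t)))\<^sup>2) \<longlonglongrightarrow> 0"
  proof (rule tendsto_sandwich[OF _ _ tendsto_const, rotated 2])
    show "\<forall>\<^sub>F t in sequentially. (norm (g (S t)))\<^sup>2 \<le> (f (S t) - f (S (Suc t))) / (\<iota> * \<tau>0)"
      using step[OF SK] \<iota> \<tau>0 by (intro always_eventually allI) (simp add: pos_le_divide_eq algebra_simps)
  qed simp
  then have "(\<lambda>t. sqrt ((norm (g (S t)))\<^sup>2)) \<longlonglongrightarrow> sqrt 0" by (rule tendsto_real_sqrt)
  then have lim: "(\<lambda>t. norm (g (S t))) \<longlonglongrightarrow> 0" by simp
  obtain l r where l: "l \<in> K" "strict_mono r" "(S \<circ> r) \<longlonglongrightarrow> l"
    using K SK unfolding compact_def by metis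
  have lM: "l \<in> M" using l by (simp add: K_def)
  have "(\<lambda>t. g ((S \<circ> r) t)) \<longlonglongrightarrow> g l"
    using continuous_on_tendsto_compose[OF g(1) l(3) lM] S by simp
  then have "(\<lambda>t. norm (g (S (r t)))) \<longlonglongrightarrow> norm (g l)" by (simp add: tendsto_norm)
  moreover have "(\<lambda>t. norm (g (S (r t)))) \<longlonglongrightarrow> 0"
    using LIMSEQ_subseq_LIMSEQ[OF lim l(2)] by (simp add: o_def)
  ultimately have "g l = 0" using LIMSEQ_unique by fastforce
  then have "critical_point M T f l" by (simp add: critical_point_def lM grad)
  then show ?thesis using l lim by (auto simp: grad[OF S(1)])
qed

section \<open>Weighted low-rank approximation\<close>

text \<open>\<open>G_hat\<close> is a polynomial in the coordinates of the triple, and these are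
  linear functions.\<close>

lemma G_hat_quadratic_expansion:
  fixes A W :: "real^'n^'m"
  shows "\<exists>F. quadratic_expansion (G_hat A W :: ('m, 'k::finite, 'n) triple \<Rightarrow> real) F"
proof -
  have P: "(U ** diag_matrix x ** transpose V) $ i $ j = (\<Sum>l\<in>UNIV. U$i$l * x$l * V$j$l)"
    for U :: "real^'k^'m" and x and V :: "real^'k^'n" and i j
    by (simp add: matrix_matrix_mult_def diag_matrix_def transpose_def if_distrib[of "\<lambda>c. _ * c"] cong: if_cong)
  \<comment> \<open>Differences and squares are rewritten through sums and products, the operations
    for which closure is known.\<close>
  have eq: "G_hat A W = (\<lambda>z :: ('m, 'k, 'n) triple. \<Sum>i\<in>UNIV. \<Sum>j\<in>UNIV. W$i$j *
    ((A$i$j + (-1) * (\<Sum>l\<in>UNIV. fst z$i$l * fst (snd z)$l * snd (snd z)$j$l)) *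
     (A$i$j + (-1) * (\<Sum>l\<in>UNIV. fst z$i$l * fst (snd z)$l * snd (snd z)$j$l))))"
    by (simp add: G_hat_def fun_eq_iff Let_def P power2_eq_square)
  have mult: "\<exists>F. quadratic_expansion (\<lambda>x. f x * g x) F"
    and add: "\<exists>F. quadratic_expansion (\<lambda>x. f x + g x) F"
    if "\<exists>F. quadratic_expansion f F" "\<exists>F. quadratic_expansion g F" for f g :: "('m, 'k, 'n) triple \<Rightarrow> real"
    using that quadratic_expansion_mult quadratic_expansion_add by blast+
  have const: "\<exists>F. quadratic_expansion (\<lambda>_ :: ('m, 'k, 'n) triple. r) F" for r
    using quadratic_expansion_const by blast
  show ?thesis
    unfolding eq
    by (intro quadratic_expansion_sum mult add const quadratic_expansion_linear)
      (auto intro!: linearI)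
qed

text \<open>The retraction is exact on the vector component, so the error comes from the two
  \<open>qf\<close> blocks alone, whose squared tangent norms add up to at most that of
  \<open>\<xi>\<close>.\<close>

lemma svd_retraction_second_order:
  fixes z :: "('m::finite, 'k::{finite,linorder}, 'n::finite) triple"
  assumes "z \<in> svd_manifold" "\<xi> \<in> svd_tangent z"
  shows "svd_retraction z \<xi> \<in> svd_manifold" "norm (svd_retraction z \<xi> - (z + \<xi>)) \<le> 2 * (norm \<xi>)\<^sup>2"
proof -
  obtain U x V where z: "z = (U, x, V)" by (cases z)
  obtain Y x' Z where \<xi>: "\<xi> = (Y, x', Z)" by (cases \<xi>)
  have U: "U \<in> stiefel" "Y \<in> stiefel_tangent U" and V: "V \<in> stiefel" "Z \<in> stiefel_tangent V"
    using assms by (auto simp: z \<xi> svd_manifold_def svd_tangent_def)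
  show "svd_retraction z \<xi> \<in> svd_manifold"
    using qf_tangent(1)[OF U] qf_tangent(1)[OF V] by (simp add: z \<xi> svd_manifold_def svd_retraction_def)
  have "svd_retraction z \<xi> - (z + \<xi>) = (qf (U + Y) - (U + Y), 0, qf (V + Z) - (V + Z))"
    by (simp add: z \<xi> svd_retraction_def)
  also have "norm \<dots> \<le> norm (qf (U + Y) - (U + Y)) + norm (qf (V + Z) - (V + Z))"
    using norm_Pair_le[of "qf (U + Y) - (U + Y)" "(0 :: (real, 'k) vec, qf (V + Z) - (V + Z))"] by (simp add: norm_Pair)
  also have "\<dots> \<le> 2 * (norm Y)\<^sup>2 + 2 * (norm Z)\<^sup>2"
    by (intro add_mono qf_tangent(2) U V)
  also have "\<dots> \<le> 2 * (norm \<xi>)\<^sup>2" by (simp add: \<xi> norm_Pair)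
  finally show "norm (svd_retraction z \<xi> - (z + \<xi>)) \<le> 2 * (norm \<xi>)\<^sup>2" .
qed

section \<open>Boundedness of the sublevel sets\<close>

lemma norm_diag_matrix: "norm (diag_matrix x) = norm x"
proof -
  have "inner (diag_matrix x) (diag_matrix x) = inner x x"
    by (simp add: inner_vec_def diag_matrix_def if_distrib[of "\<lambda>c. c * _"] cong: if_cong)
  then show ?thesis by (simp add: norm_eq_sqrt_inner)
qed

lemma norm_matrix_le_sum_abs:
  fixes P :: "real^'n^'m"
  shows "norm P \<le> (\<Sum>i\<in>UNIV. \<Sum>j\<in>UNIV. \<bar>P $ i $ j\<bar>)"
proof -
  have "norm P \<le> (\<Sum>i\<in>UNIV. norm (P $ i))" unfolding norm_vec_def by (rule L2_set_le_sum) simp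
  also have "\<dots> \<le> (\<Sum>i\<in>UNIV. \<Sum>j\<in>UNIV. \<bar>P $ i $ j\<bar>)" by (intro sum_mono norm_le_l1_cart)
  finally show ?thesis .
qed

text \<open>Orthonormal columns on both sides give \<open>x\<close> the norm of the product matrix,
  whose entries are controlled by \<open>G_hat\<close> because the weights are positive. The norms
  of \<open>U\<close> and \<open>V\<close> are fixed.\<close>

lemma bounded_G_hat_sublevel:
  fixes A W :: "real^'n^'m"
  assumes W: "\<And>i j. W $ i $ j > 0"
  shows "bounded {z \<in> svd_manifold. G_hat A W (z :: ('m, 'k::finite, 'n) triple) \<le> G0}"
proof -
  define b where "b = norm (mat 1 :: real^'k^'k)"
  define p where "p = (\<Sum>i\<in>UNIV. \<Sum>j\<in>UNIV. \<bar>A$i$j\<bar> + 1 + G0 / W$i$j)"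
  have "norm z \<le> b + (p + b)" if z: "z \<in> svd_manifold" "G_hat A W z \<le> G0" for z :: "('m, 'k, 'n) triple"
  proof -
    obtain U x V where zz: "z = (U, x, V)" by (cases z)
    have U: "U \<in> stiefel" and V: "V \<in> stiefel" using z by (auto simp: zz svd_manifold_def)
    define P where "P = U ** diag_matrix x ** transpose V"
    \<comment> \<open>After removing \<open>U\<close>, transposing puts \<open>V\<close> on the
      left, where it is an isometry as well.\<close>
    have "norm P = norm (transpose (diag_matrix x ** transpose V))"
      unfolding P_def by (simp add: stiefel_norm_mult(1)[OF U] norm_transpose flip: matrix_mul_assoc)
    also have "\<dots> = norm x"
      by (simp add: matrix_transpose_mul stiefel_norm_mult(1)[OF V] norm_transpose norm_diag_matrix)
    finally have x: "norm x = norm P" by simp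
    have G: "(\<Sum>i\<in>UNIV. \<Sum>j\<in>UNIV. W$i$j * (A$i$j - P$i$j)\<^sup>2) \<le> G0"
      using z(2) by (simp add: zz G_hat_def P_def Let_def)
    have "\<bar>P$i$j\<bar> \<le> \<bar>A$i$j\<bar> + 1 + G0 / W$i$j" for i j
    proof -
      have nonneg: "0 \<le> W$i$j * (A$i$j - P$i$j)\<^sup>2" for i j using W[of i j] by simp
      have "W$i$j * (A$i$j - P$i$j)\<^sup>2 \<le> (\<Sum>j\<in>UNIV. W$i$j * (A$i$j - P$i$j)\<^sup>2)"
        by (rule member_le_sum) (use nonneg in auto)
      also have "\<dots> \<le> (\<Sum>i\<in>UNIV. \<Sum>j\<in>UNIV. W$i$j * (A$i$j - P$i$j)\<^sup>2)"
        by (rule member_le_sum) (use nonneg in \<open>auto intro!: sum_nonneg\<close>)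
      also note G
      finally have "(A$i$j - P$i$j)\<^sup>2 \<le> G0 / W$i$j" using W[of i j] by (simp add: field_simps)
      \<comment> \<open>Passes from the squared residual to its absolute value without square roots;
        this is the origin of the 1 in \<open>p\<close>.\<close>
      moreover have "\<bar>d\<bar> \<le> 1 + d\<^sup>2" for d :: real
        using zero_le_power2[of "\<bar>d\<bar> - 1"] unfolding power2_diff by simp
      ultimately show ?thesis by (smt (verit))
    qed
    then have "norm P \<le> p" unfolding p_def by (intro order_trans[OF norm_matrix_le_sum_abs] sum_mono)
    moreover have "norm U = b" "norm V = b"
      unfolding b_def using stiefel_norm_mult(1)[OF U, of "mat 1"] stiefel_norm_mult(1)[OF V, of "mat 1"] by simp_all
    ultimately show ?thesis
      using norm_Pair_le[of U "(x, V)"] norm_Pair_le[of x V] x by (simp add: zz)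
  qed
  then show ?thesis unfolding bounded_iff by blast
qed

theorem propositionE21:
  fixes A W :: "real^'n^'m"
    and \<alpha> \<beta> \<iota> :: real
    and U0 :: "((real, 'k::{finite,linorder}) vec, 'm) vec" and x0 :: "(real, 'k) vec"
    and V0 :: "((real, 'k) vec, 'n) vec"
    and S :: "nat \<Rightarrow> ('m, 'k, 'n) triple"
  assumes "CARD('k) \<le> min CARD('m) CARD('n)"
    and "\<And>i j. W $ i $ j > 0"
    and "(\<Sum>i\<in>UNIV. \<Sum>j\<in>UNIV. W $ i $ j) = 1"
    and "\<alpha> > 0"
    and "0 < \<beta>" and "\<beta> < 1"
    and "0 < \<iota>" and "\<iota> < 1"
    and "(U0, x0, V0) \<in> svd_manifold"
    and "S 0 = (U0, x0, V0)"
    and "\<And>t. S t \<in> svd_manifold"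
    and "\<And>t. G_hat A W (S t) - G_hat A W (S (Suc t)) \<ge>
           G_hat A W (S t) -
           G_hat A W (svd_retraction (S t)
             (- armijo_step svd_manifold svd_tangent svd_retraction (G_hat A W) \<alpha> \<beta> \<iota>
                  (S t) (- grad_G_hat A W (S t)) *\<^sub>R grad_G_hat A W (S t)))"
  shows "(\<exists>r l. strict_mono r \<and> (S \<circ> r) \<longlonglongrightarrow> l \<and>
            critical_point svd_manifold svd_tangent (G_hat A W) l) \<and>
         (\<lambda>t. norm (grad_G_hat A W (S t))) \<longlonglongrightarrow> 0"
proof -
  obtain F :: "('m, 'k, 'n) triple \<Rightarrow> _" where F: "quadratic_expansion (G_hat A W) F"
    using G_hat_quadratic_expansion by blast
  \<comment> \<open>The Euclidean gradient is projected block by block; the vector block is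
    unconstrained and stays as it is.\<close>
  define g where "g z = (stiefel_proj (fst z) (fst (F z)), fst (snd (F z)), stiefel_proj (snd (snd z)) (snd (snd (F z))))" for z
  show ?thesis
  proof (rule armijo_descent_converges[OF _ _ _ _ _ _ F, where c = 2 and g = g])
    show "closed (svd_manifold :: ('m, 'k, 'n) triple set)"
      unfolding svd_manifold_def by (intro closed_Times closed_stiefel closed_UNIV)
    show "subspace (svd_tangent z)" for z :: "('m, 'k, 'n) triple"
      unfolding svd_tangent_def by (cases z) (simp add: subspace_Times subspace_stiefel_tangent)
    show "\<xi> \<in> svd_tangent (\<gamma> 0)"
      if \<gamma>: "\<And>t. \<gamma> t \<in> svd_manifold" "(\<gamma> has_vector_derivative \<xi>) (at 0)"
      for \<gamma> :: "real \<Rightarrow> ('m, 'k, 'n) triple" and \<xi>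
    proof -
      have "((\<lambda>t. fst (\<gamma> t)) has_vector_derivative fst \<xi>) (at 0)"
        "((\<lambda>t. snd (snd (\<gamma> t))) has_vector_derivative snd (snd \<xi>)) (at 0)"
        by (intro bounded_linear.has_vector_derivative[OF bounded_linear_fst]
            bounded_linear.has_vector_derivative[OF bounded_linear_snd] \<gamma>(2))+
      then have "fst \<xi> \<in> stiefel_tangent (fst (\<gamma> 0))" "snd (snd \<xi>) \<in> stiefel_tangent (snd (snd (\<gamma> 0)))"
        using \<gamma>(1) by (auto simp: svd_manifold_def mem_Times_iff
            intro: velocity_stiefel_tangent[where \<gamma> = "\<lambda>t. fst (\<gamma> t)"]
              velocity_stiefel_tangent[where \<gamma> = "\<lambda>t. snd (snd (\<gamma> t))"])
      then show ?thesis by (simp add: svd_tangent_def case_prod_unfold mem_Times_iff)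
    qed
    show "svd_retraction z \<xi> \<in> svd_manifold" "norm (svd_retraction z \<xi> - (z + \<xi>)) \<le> 2 * (norm \<xi>)\<^sup>2"
      if "z \<in> svd_manifold" "\<xi> \<in> svd_tangent z" for z \<xi> :: "('m, 'k, 'n) triple"
      using svd_retraction_second_order[OF that] by auto
    have "continuous_on svd_manifold F"
      using quadratic_expansion_continuous[OF F] by (rule continuous_on_subset) simp
    then show "continuous_on svd_manifold g"
      unfolding g_def by (intro continuous_intros)
    show "g z \<in> svd_tangent z" if "z \<in> svd_manifold" for z
      using that
      by (auto simp: g_def svd_manifold_def svd_tangent_def case_prod_unfold mem_Times_iff
          intro: stiefel_proj_tangent)
    show "inner (g z) \<xi> = inner (F z) \<xi>" if "\<xi> \<in> svd_tangent z" for z \<xi>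
      using that by (simp add: g_def svd_tangent_def case_prod_unfold mem_Times_iff inner_prod_def inner_stiefel_proj)
    show "bounded {z \<in> svd_manifold. G_hat A W z \<le> G_hat A W (S 0)}"
      using assms(2) by (rule bounded_G_hat_sublevel)
    show "G_hat A W (S (Suc t)) \<le> G_hat A W (svd_retraction (S t)
             (- armijo_step svd_manifold svd_tangent svd_retraction (G_hat A W) \<alpha> \<beta> \<iota>
                  (S t) (- grad_G_hat A W (S t)) *\<^sub>R grad_G_hat A W (S t)))" for t
      using assms(12)[of t] by simp
  qed (use assms in auto)
qed

end
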